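(* Let $\mathcal{C}$ be a completely decomposable $[n,k]_{q^m/q}$ code of type $(n_1,\ldots,n_k)$. Let $n_k=\ldots=n_{k-\ell}\neq n_{k-\ell-1}$, for some $\ell\in\{1,\ldots,k-1\}$, with $n_0:=0$. If $$A_{n_k}(\mathcal{C})=(q^m-1)\frac{q^{(\ell+1)(m-n_k)}-1}{q^{m-n_k}-1},$$ then $m=re$ for some integers $r>1$ and $e\geq1$, $n_k=(r-1)e$, and up to equivalence (that is, after replacing $\mathcal{C}$ by a suitable equivalent code with a generator matrix in a weight complementary form) $$\Pi(\mathcal{C},k-\ell)=\underbrace{\mathcal{C}'\oplus\ldots\oplus\mathcal{C}'}_{\ell+1},$$ where $\mathcal{C}'=\langle\mathbf{u}\rangle_{\mathbb{F}_{q^m}}$ and the entries of $\mathbf{u}$ form an $\mathbb{F}_q$-basis of an $\mathbb{F}_{q^e}$-hyperplane of $\mathbb{F}_{q^m}$. In particular, if $\ell=k-1$, then up to equivalence $$\mathcal{C}=\bigoplus_{i=1}^k\mathcal{C}',$$ with $\mathcal{C}'=\langle\mathbf{u}\rangle_{\mathbb{F}_{q^m}}$, where the entries of $\mathbf{u}$ form an $\mathbb{F}_q$-basis of an $\mathbb{F}_{q^e}$-hyperplane of $\mathbb{F}_{q^m}$.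
   Context: Let $q$ be a prime power. The rank weight (here: weight) of $\mathbf{v}\in\mathbb{F}_{q^m}^n$ is the $\mathbb{F}_q$-dimension $\mathrm{w}(\mathbf{v})$ of the $\mathbb{F}_q$-span of its entries. $A_i(\mathcal{C})$ is the number of codewords of $\mathcal{C}$ of weight $i$. An $[n,k]_{q^m/q}$ code is a $k$-dimensional $\mathbb{F}_{q^m}$-subspace $\mathcal{C}$ of $\mathbb{F}_{q^m}^n$; a generator matrix is $G\in\mathbb{F}_{q^m}^{k\times n}$ with $\mathcal{C}=\{\mathbf{x}G:\mathbf{x}\in\mathbb{F}_{q^m}^k\}$. Two codes in $\mathbb{F}_{q^m}^n$ are equivalent if one is obtained from the other by right multiplication by some $A\in\mathrm{GL}(n,q)$. The (external) direct sum of codes $\mathcal{C}_i\subseteq\mathbb{F}_{q^m}^{n_i}$, $i=1,\ldots,s$, is $\{(\mathbf{c}_1,\ldots,\mathbf{c}_s):\mathbf{c}_i\in\mathcal{C}_i\}\subseteq\mathbb{F}_{q^m}^{n_1+\ldots+n_s}$. For integers $m>n_1\geq\ldots\geq n_k\geq1$, an $[n,k]_{q^m/q}$ code is completely decomposable of type $(n_1,\ldots,n_k)$ if $n=n_1+\ldots+n_k$ and it is equivalent to a code having a block-diagonal generator matrix $\mathbf{u}_1\oplus\ldots\oplus\mathbf{u}_k$ with $\mathbf{u}_i\in\mathbb{F}_{q^m}^{1\times n_i}$ and $\mathrm{w}(\mathbf{u}_i)=n_i$ for each $i$. A generator matrix of this block-diagonal form is said to be in a weight complementary form. For a code $\mathcal{C}$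 with such a generator matrix and $t\in\{1,\ldots,k\}$, the $t$-punctured code is $\Pi(\mathcal{C},t)=\{(\alpha_t\mathbf{u}_t,\ldots,\alpha_k\mathbf{u}_k):\alpha_i\in\mathbb{F}_{q^m}\}\subseteq\mathbb{F}_{q^m}^{n_t+\ldots+n_k}$. An $\mathbb{F}_{q^e}$-hyperplane of $\mathbb{F}_{q^m}$ ($m=re$) is an $\mathbb{F}_{q^e}$-subspace of $\mathbb{F}_{q^m}$ of $\mathbb{F}_{q^e}$-dimension $r-1$. *)

theory Defs
  imports
    Complex_Main
    "HOL-Algebra.Embedded_Algebras"
    "Jordan_Normal_Form.VS_Connect"
begin

text \<open>
  The field with \<open>q ^ m\<close> elements is a type \<open>'a\<close> of class \<open>{field, finite}\<close>, regarded as a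
  HOL-Algebra ring via \<^term>\<open>class_ring\<close>; its subfields are subsets of \<open>'a\<close>, a subfield with
  \<open>p\<close> elements being unique if it exists. In the definitions \<open>K\<close> is the subfield with \<open>q\<close> elements.
\<close>

subsection \<open>Rank weight and codes\<close>

definition rank_weight :: "'a::field set \<Rightarrow> 'a vec \<Rightarrow> nat" where
  "rank_weight K v = ring.dim class_ring K (ring.Span class_ring K (list_of_vec v))"

definition weight_count :: "'a::field set \<Rightarrow> 'a vec set \<Rightarrow> nat \<Rightarrow> nat" where
  "weight_count K C i = card {c \<in> C. rank_weight K c = i}"

definition linear_code :: "nat \<Rightarrow> nat \<Rightarrow> 'a::field vec set \<Rightarrow> bool" where
  "linear_code n k C \<longleftrightarrow>
     VectorSpace.subspace class_ring C (module_vec TYPE('a) n) \<and>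
     vectorspace.dim class_ring (module_vec TYPE('a) n \<lparr>carrier := C\<rparr>) = k"

text \<open>The row vector \<open>x G\<close>; the matrix library multiplies column vectors only.\<close>

definition row_mult :: "'a::field vec \<Rightarrow> 'a mat \<Rightarrow> 'a vec" where
  "row_mult x G = G\<^sup>T *\<^sub>v x"

definition generator_matrix :: "nat \<Rightarrow> nat \<Rightarrow> 'a::field mat \<Rightarrow> 'a vec set \<Rightarrow> bool" where
  "generator_matrix n k G C \<longleftrightarrow>
     linear_code n k C \<and> G \<in> carrier_mat k n \<and> C = (\<lambda>x. row_mult x G) ` carrier_vec k"

definition GL_over :: "nat \<Rightarrow> 'a::field set \<Rightarrow> 'a mat set" where
  "GL_over n K = {A \<in> carrier_mat n n. elements_mat A \<subseteq> K \<and>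
     (\<exists>B \<in> carrier_mat n n. elements_mat B \<subseteq> K \<and> inverts_mat A B \<and> inverts_mat B A)}"

definition equivalent_codes :: "'a::field set \<Rightarrow> nat \<Rightarrow> 'a vec set \<Rightarrow> 'a vec set \<Rightarrow> bool" where
  "equivalent_codes K n C D \<longleftrightarrow> (\<exists>A \<in> GL_over n K. D = (\<lambda>c. row_mult c A) ` C)"

definition concat_vec :: "'a vec list \<Rightarrow> 'a vec" where
  "concat_vec vs = foldr (@\<^sub>v) vs vNil"

definition direct_sum_codes :: "'a vec set list \<Rightarrow> 'a vec set" where
  "direct_sum_codes Cs = concat_vec ` listset Cs"

definition line_code :: "'a::field vec \<Rightarrow> 'a vec set" where
  "line_code u = {a \<cdot>\<^sub>v u | a. True}"

subsection \<open>Completely decomposable codes\<close>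

text \<open>The type \<open>(n\<^sub>1, \<dots>, n\<^sub>k)\<close> and the blocks \<open>u\<^sub>1, \<dots>, u\<^sub>k\<close> are functions on \<open>nat\<close> of which only the
  values at \<open>1, \<dots>, k\<close> are used.\<close>

definition weight_complementary_form ::
  "'a::field set \<Rightarrow> nat \<Rightarrow> nat \<Rightarrow> (nat \<Rightarrow> nat) \<Rightarrow> (nat \<Rightarrow> 'a vec) \<Rightarrow> 'a vec set \<Rightarrow> bool" where
  "weight_complementary_form K n k ns u C \<longleftrightarrow>
     (\<forall>i\<in>{1..k}. u i \<in> carrier_vec (ns i) \<and> rank_weight K (u i) = ns i) \<and>
     generator_matrix n k (diag_block_mat (map (\<lambda>i. mat_of_row (u i)) [1..<Suc k])) C"

definition completely_decomposable ::
  "'a::field set \<Rightarrow> nat \<Rightarrow> nat \<Rightarrow> nat \<Rightarrow> (nat \<Rightarrow> nat) \<Rightarrow> 'a vec set \<Rightarrow> bool" where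
  "completely_decomposable K m n k ns C \<longleftrightarrow>
     linear_code n k C \<and>
     (\<forall>i\<in>{1..k}. 1 \<le> ns i \<and> ns i < m) \<and> antimono_on {1..k} ns \<and>
     n = (\<Sum>i=1..k. ns i) \<and>
     (\<exists>D u. equivalent_codes K n C D \<and> weight_complementary_form K n k ns u D)"

text \<open>The punctured code depends on the code only through the blocks \<open>u\<close> of its generator matrix.\<close>

definition punctured_code :: "nat \<Rightarrow> (nat \<Rightarrow> 'a::field vec) \<Rightarrow> nat \<Rightarrow> 'a vec set" where
  "punctured_code k u t =
     {concat_vec (map (\<lambda>i. a i \<cdot>\<^sub>v u i) [t..<Suc k]) | a :: nat \<Rightarrow> 'a. True}"

subsection \<open>Hyperplanes over an intermediate field\<close>

definition hyperplane_over :: "'a::field set \<Rightarrow> 'a set \<Rightarrow> bool" where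
  "hyperplane_over L H \<longleftrightarrow>
     (\<exists>r\<ge>1. ring.dimension class_ring r L UNIV \<and> ring.dimension class_ring (r - 1) L H)"

definition basis_over :: "'a::field set \<Rightarrow> 'a list \<Rightarrow> 'a set \<Rightarrow> bool" where
  "basis_over K us H \<longleftrightarrow>
     ring.independent class_ring K us \<and> ring.Span class_ring K us = H"

definition entries_basis_of_hyperplane :: "'a::field set \<Rightarrow> nat \<Rightarrow> 'a vec \<Rightarrow> bool" where
  "entries_basis_of_hyperplane K e u \<longleftrightarrow>
     (\<exists>L H. subfield L class_ring \<and> card L = card K ^ e \<and>
        hyperplane_over L H \<and> basis_over K (list_of_vec u) H)"

end

theory Submission
  imports Defs
begin

text \<open>
  Let \<open>U i\<close> be the span of the entries of \<open>u i\<close>, and let \<open>d = ns k\<close>, \<open>Q = q ^ (m - d)\<close>. A word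
  \<open>(a 1 u 1, \<dots>, a k u k)\<close> of weight \<open>d\<close> is supported on the blocks of length \<open>d\<close>, and all its nonzero
  \<open>a i U i\<close> agree. For subspaces \<open>U\<close>, \<open>W\<close> of dimension \<open>d\<close> there are at most \<open>Q\<close> scalars \<open>c\<close> with
  \<open>c U \<subseteq> W\<close>, because \<open>(c, w) \<mapsto> c x + w\<close> is injective for any fixed \<open>x \<notin> U\<close>. Fixing the first nonzero
  coefficient therefore bounds the number of these words by the number in the hypothesis. Equality
  forces \<open>Q\<close> scalars mapping each \<open>U j\<close> into the first block's \<open>U\<close>: all blocks are multiples of one
  space, whose stabilizer is a field with \<open>Q\<close> elements over which it is a hyperplane. A change of
  basis in each block then makes the blocks equal.
\<close>

subsection \<open>Spans over a subfield\<close>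

lemma combine_class_ring:
  fixes us :: "'a::field list"
  assumes "length ks = length us"
  shows "ring.combine class_ring ks us = (\<Sum>j<length us. ks ! j * us ! j)"
  using assms
proof (induction ks us rule: list_induct2)
  case (Cons k ks u us)
  then show ?case
    by (simp add: ring.combine.simps[OF class_ring.ring_axioms] sum.lessThan_Suc_shift del: sum.lessThan_Suc)
qed (simp add: ring.combine.simps[OF class_ring.ring_axioms])

lemma Span_eq_combine:
  fixes K :: "'a::field set"
  assumes "subfield K class_ring"
  shows "ring.Span class_ring K us =
    (\<lambda>ks. ring.combine class_ring ks us) ` {ks. set ks \<subseteq> K \<and> length ks = length us}"
  using ring.Span_eq_combine_set_length_version[OF class_ring.ring_axioms assms, of us] by auto

lemma mem_Span_iff:
  fixes K :: "'a::field set"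
  assumes "subfield K class_ring"
  shows "x \<in> ring.Span class_ring K us \<longleftrightarrow>
    (\<exists>f. (\<forall>j<length us. f j \<in> K) \<and> x = (\<Sum>j<length us. f j * us ! j))"
proof
  assume "x \<in> ring.Span class_ring K us"
  then obtain ks where ks: "set ks \<subseteq> K" "length ks = length us" "x = ring.combine class_ring ks us"
    unfolding Span_eq_combine[OF assms] by blast
  then show "\<exists>f. (\<forall>j<length us. f j \<in> K) \<and> x = (\<Sum>j<length us. f j * us ! j)"
    by (intro exI[of _ "\<lambda>j. ks ! j"]) (auto simp: combine_class_ring)
next
  assume "\<exists>f. (\<forall>j<length us. f j \<in> K) \<and> x = (\<Sum>j<length us. f j * us ! j)"
  then obtain f where f: "\<forall>j<length us. f j \<in> K" "x = (\<Sum>j<length us. f j * us ! j)" by blast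
  let ?ks = "map f [0..<length us]"
  have "set ?ks \<subseteq> K" "length ?ks = length us" "x = ring.combine class_ring ?ks us"
    using f by (auto simp: combine_class_ring)
  then show "x \<in> ring.Span class_ring K us"
    unfolding Span_eq_combine[OF assms] by blast
qed

lemma subfield_class_ring_closed:
  fixes K :: "'a::field set"
  assumes "subfield K class_ring"
  shows "0 \<in> K" "1 \<in> K" "x \<in> K \<Longrightarrow> y \<in> K \<Longrightarrow> x + y \<in> K" "x \<in> K \<Longrightarrow> y \<in> K \<Longrightarrow> x * y \<in> K"
    "x \<in> K \<Longrightarrow> - x \<in> K"
  using subringE[OF subfieldE(1)[OF assms]] by (simp_all add: class_ring_simps)

lemma subfield_class_ring_sum:
  fixes K :: "'a::field set"
  assumes "subfield K class_ring" "\<And>i. i \<in> I \<Longrightarrow> f i \<in> K"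
  shows "sum f I \<in> K"
  using assms(2)
  by (induction I rule: infinite_finite_induct) (auto simp: subfield_class_ring_closed[OF assms(1)])

lemma card_subfield_gt_1:
  fixes K :: "'a::{field,finite} set"
  assumes "subfield K class_ring"
  shows "card K > 1"
proof -
  have "card {0, 1::'a} \<le> card K"
    by (intro card_mono) (auto simp: subfield_class_ring_closed[OF assms])
  then show ?thesis by simp
qed

lemma Span_closed:
  fixes K :: "'a::field set"
  assumes K: "subfield K class_ring"
  shows "0 \<in> ring.Span class_ring K us"
    "x \<in> ring.Span class_ring K us \<Longrightarrow> y \<in> ring.Span class_ring K us \<Longrightarrow> x + y \<in> ring.Span class_ring K us"
    "x \<in> ring.Span class_ring K us \<Longrightarrow> y \<in> ring.Span class_ring K us \<Longrightarrow> x - y \<in> ring.Span class_ring K us"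
    "c \<in> K \<Longrightarrow> x \<in> ring.Span class_ring K us \<Longrightarrow> c * x \<in> ring.Span class_ring K us"
    "set us \<subseteq> ring.Span class_ring K us"
proof -
  show zero: "0 \<in> ring.Span class_ring K us"
    and add: "x \<in> ring.Span class_ring K us \<Longrightarrow> y \<in> ring.Span class_ring K us \<Longrightarrow> x + y \<in> ring.Span class_ring K us"
    for x y
    using ring.Span_subgroup_props[OF class_ring.ring_axioms K, of us] by (simp_all add: class_ring_simps)
  have "x \<in> ring.Span class_ring K us \<Longrightarrow> - x \<in> ring.Span class_ring K us" for x
    using ring.Span_subgroup_props[OF class_ring.ring_axioms K, of us] by (simp add: class_ring_simps)
  then show "x \<in> ring.Span class_ring K us \<Longrightarrow> y \<in> ring.Span class_ring K us \<Longrightarrow> x - y \<in> ring.Span class_ring K us"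
    using add[of x "- y"] by simp
  show "c \<in> K \<Longrightarrow> x \<in> ring.Span class_ring K us \<Longrightarrow> c * x \<in> ring.Span class_ring K us"
    using ring.Span_smult_closed[OF class_ring.ring_axioms K, of us] by (simp add: class_ring_simps)
  show "set us \<subseteq> ring.Span class_ring K us"
    using ring.Span_base_incl[OF class_ring.ring_axioms K, of us] by (simp add: class_ring_simps)
qed

lemma Span_sum_closed:
  fixes K :: "'a::field set"
  assumes K: "subfield K class_ring" and "\<And>i. i \<in> I \<Longrightarrow> f i \<in> ring.Span class_ring K us"
  shows "sum f I \<in> ring.Span class_ring K us"
  using assms(2)
  by (induction I rule: infinite_finite_induct) (auto simp: Span_closed[OF K])

text \<open>Multiplication by \<open>c\<close> commutes with \<open>K\<close>-combinations, so
  checking the generators is enough. The case \<open>c = 1\<close> serves as monotonicity of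
  spans.\<close>

lemma scaled_Span_subset:
  fixes K :: "'a::field set"
  assumes K: "subfield K class_ring" and "(\<lambda>u. c * u) ` set us \<subseteq> ring.Span class_ring K vs"
  shows "(*) c ` ring.Span class_ring K us \<subseteq> ring.Span class_ring K vs"
proof
  fix y assume "y \<in> (*) c ` ring.Span class_ring K us"
  then obtain f where f: "\<forall>j<length us. f j \<in> K" "y = c * (\<Sum>j<length us. f j * us ! j)"
    unfolding image_iff by (auto simp: mem_Span_iff[OF K])
  then have "y = (\<Sum>j<length us. f j * (c * us ! j))"
    by (simp add: sum_distrib_left mult.left_commute)
  also have "\<dots> \<in> ring.Span class_ring K vs"
  proof (intro Span_sum_closed[OF K])
    fix j assume "j \<in> {..<length us}"
    then have "f j \<in> K" "us ! j \<in> set us" using f(1) by auto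
    moreover from this(2) have "c * us ! j \<in> ring.Span class_ring K vs"
      using assms(2) by blast
    ultimately show "f j * (c * us ! j) \<in> ring.Span class_ring K vs"
      by (simp add: Span_closed(4)[OF K])
  qed
  finally show "y \<in> ring.Span class_ring K vs" .
qed

text \<open>Coordinates in a basis give a bijection from lists of length \<open>n\<close> over
  \<open>K\<close> to \<open>E\<close>. Through this lemma dimensions are compared by counting, also
  between different base fields.\<close>

lemma card_dimension:
  fixes K :: "'a::{field,finite} set"
  assumes K: "subfield K class_ring" and "ring.dimension class_ring n K E"
  shows "card E = card K ^ n"
proof -
  obtain Vs where Vs: "ring.independent class_ring K Vs" "length Vs = n"
    "ring.Span class_ring K Vs = E"
    using ring.exists_base[OF class_ring.ring_axioms K assms(2)] by auto
  let ?L = "{ks. set ks \<subseteq> K \<and> length ks = n}"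
  have img: "(\<lambda>ks. ring.combine class_ring ks Vs) ` ?L = E"
    unfolding Vs(3)[symmetric] Span_eq_combine[OF K] Vs(2) ..
  have "bij_betw (\<lambda>ks. ring.combine class_ring ks Vs) ?L E"
    unfolding bij_betw_def
  proof
    show "inj_on (\<lambda>ks. ring.combine class_ring ks Vs) ?L"
    proof (rule inj_onI)
      fix x y assume *: "x \<in> ?L" "y \<in> ?L" "ring.combine class_ring x Vs = ring.combine class_ring y Vs"
      then have "ring.combine class_ring x Vs \<in> ring.Span class_ring K Vs"
        unfolding Vs(3) img[symmetric] by blast
      from ring.unique_decomposition[OF class_ring.ring_axioms K Vs(1) this]
      obtain z where "\<And>ks. set ks \<subseteq> K \<and> length ks = length Vs \<and>
          ring.combine class_ring x Vs = ring.combine class_ring ks Vs \<Longrightarrow> ks = z"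
        by (elim ex1E) (rule that, blast)
      from this[of x] this[of y] show "x = y" using * Vs(2) by simp
    qed
  qed (rule img)
  from bij_betw_same_card[OF this, symmetric] show ?thesis by (simp add: card_lists_length_eq)
qed

lemma card_Span:
  fixes K :: "'a::{field,finite} set"
  assumes K: "subfield K class_ring"
  shows "card (ring.Span class_ring K us) = card K ^ ring.dim class_ring K (ring.Span class_ring K us)"
proof -
  have fd: "ring.finite_dimension class_ring K (ring.Span class_ring K us)"
    using ring.Span_finite_dimension[OF class_ring.ring_axioms K, of us] by simp
  then show ?thesis
    using card_dimension[OF K ring.finite_dimensionE[OF class_ring.ring_axioms K fd]] by (simp add: over_def)
qed

text \<open>Coefficient lists map onto the span. If both finite sets have the same size, this
  surjection is injective, and then only the zero list combines to 0.\<close>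

lemma independent_of_card_Span:
  fixes K :: "'a::{field,finite} set"
  assumes K: "subfield K class_ring" and "card (ring.Span class_ring K us) = card K ^ length us"
  shows "ring.independent class_ring K us"
proof -
  let ?L = "{ks. set ks \<subseteq> K \<and> length ks = length us}"
  have "(\<lambda>ks. ring.combine class_ring ks us) ` ?L = ring.Span class_ring K us"
    unfolding Span_eq_combine[OF K] ..
  moreover have "card ?L = card K ^ length us" "finite ?L"
    by (simp_all add: card_lists_length_eq finite_lists_length_eq)
  ultimately have inj: "inj_on (\<lambda>ks. ring.combine class_ring ks us) ?L"
    using assms(2) by (intro eq_card_imp_inj_on) auto
  show ?thesis
  proof (rule ccontr)
    assume dep: "\<not> ring.independent class_ring K us"
    obtain ks where ks: "length ks = length us" "ring.combine class_ring ks us = 0" "set ks \<subseteq> K" "set ks \<noteq> {0}"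
    proof (rule ring.dependent_imp_non_trivial_combine[OF class_ring.ring_axioms K _ dep])
      fix ks assume "length ks = length us" "ring.combine class_ring ks us = \<zero>\<^bsub>class_ring\<^esub>"
        "set ks \<subseteq> K" "set ks \<noteq> {\<zero>\<^bsub>class_ring\<^esub>}"
      then show thesis by (intro that) simp_all
    qed simp
    let ?z = "replicate (length us) (0::'a)"
    have z: "ring.combine class_ring ?z us = 0" by (simp add: combine_class_ring)
    have "ks = ?z"
    proof (rule inj_onD[OF inj])
      show "ring.combine class_ring ks us = ring.combine class_ring ?z us" using z ks(2) by simp
      show "ks \<in> ?L" using ks by simp
      show "?z \<in> ?L" using subfield_class_ring_closed(1)[OF K] by auto
    qed
    \<comment> \<open>For a nonempty family the zero list contradicts
      \<open>set ks \<noteq> {0}\<close>; the empty family is independent anyway.\<close>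
    then have "us = []" using ks(4) by (auto simp: set_replicate_conv_if split: if_splits)
    with dep show False by (simp add: ring.li_Nil[OF class_ring.ring_axioms])
  qed
qed

text \<open>The finite set \<open>E\<close> serves as its own spanning family: closure under sums
  and \<open>L\<close>-multiples keeps the span of all its elements inside \<open>E\<close>.\<close>

lemma dimension_of_closed:
  fixes L :: "'a::{field,finite} set"
  assumes L: "subfield L class_ring" and zero: "0 \<in> E"
    and add: "\<And>x y. x \<in> E \<Longrightarrow> y \<in> E \<Longrightarrow> x + y \<in> E"
    and scale: "\<And>c x. c \<in> L \<Longrightarrow> x \<in> E \<Longrightarrow> c * x \<in> E"
  shows "\<exists>n. ring.dimension class_ring n L E"
proof -
  obtain us where us: "set us = E" using finite_list[of E] by auto
  have sum: "sum f I \<in> E" if "\<And>i. i \<in> I \<Longrightarrow> f i \<in> E" for f and I :: "nat set"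
    using that by (induction I rule: infinite_finite_induct) (auto simp: zero add)
  have "ring.Span class_ring L us = E"
  proof
    show "ring.Span class_ring L us \<subseteq> E"
    proof
      fix x assume "x \<in> ring.Span class_ring L us"
      then obtain f where f: "\<forall>j<length us. f j \<in> L" "x = (\<Sum>j<length us. f j * us ! j)"
        unfolding mem_Span_iff[OF L] by blast
      moreover have "f j * us ! j \<in> E" if "j < length us" for j
        using f(1) us that by (intro scale) auto
      ultimately show "x \<in> E" by (auto intro: sum)
    qed
  qed (use Span_closed(5)[OF L, of us] us in simp)
  then show ?thesis
    using ring.Span_finite_dimension[OF class_ring.ring_axioms L, of us] unfolding ring.finite_dimension_def[OF class_ring.ring_axioms]
    by auto
qed

subsection \<open>Scalars mapping one subspace into another\<close>

text \<open>Scaling by a nonzero \<open>c\<close> is injective, and an inclusion between finite sets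
  of the same size is an equality.\<close>

lemma image_scale_eq_of_subset:
  fixes U W :: "'a::{field,finite} set"
  assumes "(*) c ` U \<subseteq> W" "c \<noteq> 0" "card U = card W"
  shows "(*) c ` U = W"
  using assms card_image[of "(*) c" U]
  by (intro card_subset_eq) (auto simp: inj_on_def)

text \<open>Suppose \<open>c x + w = c' x + w'\<close> with \<open>c \<noteq> c'\<close>. Then
  \<open>c - c'\<close> also maps \<open>U\<close> into \<open>W\<close>, hence onto
  \<open>W\<close> by counting. Since \<open>(c - c') x = w' - w\<close> lies in \<open>W\<close>,
  it equals \<open>(c - c') u\<close> for some \<open>u\<close> in \<open>U\<close>, which puts
  \<open>x\<close> in \<open>U\<close>.\<close>

lemma card_scalars_into_le:
  fixes U W :: "'a::{field,finite} set"
  assumes diff: "\<And>x y. x \<in> W \<Longrightarrow> y \<in> W \<Longrightarrow> x - y \<in> W"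
    and card: "card U = card W" and "U \<noteq> UNIV"
  shows "card {c. (*) c ` U \<subseteq> W} * card W \<le> card (UNIV :: 'a set)"
proof -
  obtain x where x: "x \<notin> U" using \<open>U \<noteq> UNIV\<close> by blast
  let ?T = "{c. (*) c ` U \<subseteq> W}"
  have "inj_on (\<lambda>(c, w). c * x + w) (?T \<times> W)"
  proof (rule inj_onI, clarsimp)
    fix c w c' w' assume c: "(*) c ` U \<subseteq> W" "(*) c' ` U \<subseteq> W" and w: "w \<in> W" "w' \<in> W"
      and eq: "c * x + w = c' * x + w'"
    have "c = c'"
    proof (rule ccontr)
      assume "c \<noteq> c'"
      have "(*) (c - c') ` U \<subseteq> W"
        using c by (auto simp: left_diff_distrib intro!: diff)
      then have "(*) (c - c') ` U = W"
        using \<open>c \<noteq> c'\<close> card by (intro image_scale_eq_of_subset) auto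
      moreover have "(c - c') * x = w' - w" using eq by (simp add: algebra_simps)
      then have "(c - c') * x \<in> W" using diff w by simp
      ultimately obtain u where "u \<in> U" "(c - c') * x = (c - c') * u" by blast
      then show False using x \<open>c \<noteq> c'\<close> by simp
    qed
    then show "c = c' \<and> w = w'" using eq by simp
  qed
  then have "card (?T \<times> W) \<le> card (UNIV :: 'a set)"
    by (intro card_inj_on_le) auto
  then show ?thesis by (simp add: card_cartesian_product)
qed

text \<open>The ring axioms follow from \<open>U\<close> being an additive group. Inverses come from
  finiteness: a nonzero \<open>c\<close> in the stabilizer maps \<open>U\<close> onto itself, so
  \<open>inverse c\<close> maps \<open>U\<close> back into \<open>U\<close>.\<close>

lemma subfield_stabilizer:
  fixes U :: "'a::{field,finite} set"
  assumes diff: "\<And>x y. x \<in> U \<Longrightarrow> y \<in> U \<Longrightarrow> x - y \<in> U" and zero: "0 \<in> U"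
  shows "subfield {c. (*) c ` U \<subseteq> U} class_ring" (is "subfield ?L _")
proof -
  have add: "x + y \<in> U" if "x \<in> U" "y \<in> U" for x y
    using diff[OF that(1) diff[OF zero that(2)]] by simp
  have sub: "subring ?L class_ring"
  proof (rule ring.subringI[OF class_ring.ring_axioms])
    fix c c' assume "c \<in> ?L" "c' \<in> ?L"
    then have c: "\<And>x. x \<in> U \<Longrightarrow> c * x \<in> U" "\<And>x. x \<in> U \<Longrightarrow> c' * x \<in> U" by auto
    show "c \<oplus>\<^bsub>class_ring\<^esub> c' \<in> ?L"
      using add[OF c(1) c(2)] by (simp add: image_subset_iff distrib_right)
    show "c \<otimes>\<^bsub>class_ring\<^esub> c' \<in> ?L"
      using c(1)[OF c(2)] by (simp add: image_subset_iff mult.assoc)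
    have "0 - c * x \<in> U" if "x \<in> U" for x
      using diff[OF zero c(1)[OF that]] .
    then show "\<ominus>\<^bsub>class_ring\<^esub> c \<in> ?L"
      by (simp add: image_subset_iff class_ring_simps)
  qed auto
  have inv: "m_inv class_ring c \<in> ?L" if "c \<in> ?L - {0}" for c
  proof -
    from that have img: "(*) c ` U = U" by (intro image_scale_eq_of_subset) auto
    have "inverse c * x \<in> U" if "x \<in> U" for x
    proof -
      have "x \<in> (*) c ` U" using that img by simp
      then obtain u where "u \<in> U" "x = c * u" by auto
      then show ?thesis using \<open>c \<in> ?L - {0}\<close> by (simp add: mult.assoc[symmetric])
    qed
    then show ?thesis using that by (auto simp: class_ring_simps)
  qed
  show ?thesis
    by (rule field.subfieldI'[OF class_field sub]) (use inv in simp)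
qed

lemma prod_le_power_card:
  fixes Q :: nat
  assumes "\<And>j. j \<in> J \<Longrightarrow> f j \<le> Q"
  shows "prod f J \<le> Q ^ card J"
  using prod_mono[of J f "\<lambda>_. Q"] assms by simp

text \<open>Sorting the tuples by the position \<open>i\<close> and the value \<open>b\<close> of their first nonzero entry
  leaves at most \<open>Q\<close> choices for each later entry.\<close>

lemma count_aligned_tuples:
  fixes U :: "nat \<Rightarrow> 'a::{field,finite} set" and p k Q d :: nat
  assumes pk: "p \<le> k"
    and diff: "\<And>i x y. i \<in> {p..k} \<Longrightarrow> x \<in> U i \<Longrightarrow> y \<in> U i \<Longrightarrow> x - y \<in> U i"
    and card: "\<And>i. i \<in> {p..k} \<Longrightarrow> card (U i) = d"
    and d: "d > 0" "d * Q = card (UNIV :: 'a set)" and Q: "Q > 1"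
  defines "X \<equiv> {a \<in> {p..k} \<rightarrow>\<^sub>E UNIV. (\<exists>i\<in>{p..k}. a i \<noteq> 0) \<and>
      (\<exists>W. \<forall>i\<in>{p..k}. a i \<noteq> 0 \<longrightarrow> (*) (a i) ` U i = W)}"
  shows "card X \<le> (card (UNIV :: 'a set) - 1) * (\<Sum>i<k - p + 1. Q ^ i)"
    and "card X = (card (UNIV :: 'a set) - 1) * (\<Sum>i<k - p + 1. Q ^ i) \<Longrightarrow> j \<in> {p<..k} \<Longrightarrow>
      card {c. (*) c ` U j \<subseteq> U p} = Q"
proof -
  define T where "T W j = {c. (*) c ` U j \<subseteq> W}" for W j
  \<comment> \<open>Alignment is relaxed here: after the first nonzero entry \<open>b\<close> at
    position \<open>i\<close>, each later entry only has to map \<open>U j\<close> into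
    \<open>b U i\<close>, which admits 0. This makes \<open>Y i b\<close> a product set whose size
    is a product.\<close>
  define Y where "Y i b = ({p..k} \<rightarrow>\<^sub>E (UNIV :: 'a set)) \<inter>
      PiE {p..k} (\<lambda>j. if j < i then {0} else if j = i then {b} else T ((*) b ` U i) j)" for i b
  let ?P = "{p..k} \<times> (UNIV - {0::'a})"
  have fin: "finite ({p..k} \<rightarrow>\<^sub>E (UNIV :: 'a set))" by (intro finite_PiE) auto
  have T_le: "card (T ((*) b ` U i) j) \<le> Q" if "b \<noteq> 0" "i \<in> {p..k}" "j \<in> {p..k}" for i j b
  proof -
    have W: "card ((*) b ` U i) = d"
      using that card[of i] by (subst card_image) (auto simp: inj_on_def)
    \<comment> \<open>The bound on scalars needs an element outside \<open>U j\<close>; it exists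
      because the field has \<open>d * Q > d\<close> elements.\<close>
    have "U j \<noteq> UNIV"
    proof
      assume "U j = UNIV"
      then have "d = d * Q" using card[OF that(3)] d by simp
      then show False using d Q by simp
    qed
    moreover have "x - y \<in> (*) b ` U i" if "x \<in> (*) b ` U i" "y \<in> (*) b ` U i" for x y
      using that diff[OF \<open>i \<in> {p..k}\<close>] by (auto simp: right_diff_distrib[symmetric])
    ultimately have "card (T ((*) b ` U i) j) * d \<le> card (UNIV :: 'a set)"
      unfolding T_def using card_scalars_into_le[of "(*) b ` U i" "U j"] card[OF that(3)]
      by (metis W)
    then show ?thesis using d by (metis mult.commute mult_le_cancel1)
  qed
  have card_Y: "card (Y i b) = (\<Prod>j\<in>{i<..k}. card (T ((*) b ` U i) j))" if "i \<in> {p..k}" for i b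
  proof -
    have "card (Y i b) = (\<Prod>j\<in>{p..k}. card (if j < i then {0} else if j = i then {b} else T ((*) b ` U i) j))"
      unfolding Y_def by (subst Int_absorb1) (auto simp: card_PiE PiE_mono)
    also have "\<dots> = (\<Prod>j\<in>{i<..k}. card (T ((*) b ` U i) j))"
      \<comment> \<open>Positions up to \<open>i\<close> are prescribed, so they contribute factors
        1.\<close>
      using that by (intro prod.mono_neutral_cong_right) auto
    finally show ?thesis .
  qed
  have Y_le: "card (Y (fst x) (snd x)) \<le> Q ^ (k - fst x)" if "x \<in> ?P" for x
  proof -
    define i b where "i = fst x" and "b = snd x"
    have x: "i \<in> {p..k}" "b \<noteq> 0" using that by (auto simp: i_def b_def)
    have "(\<Prod>j\<in>{i<..k}. card (T ((*) b ` U i) j)) \<le> Q ^ card {i<..k}"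
      using x by (intro prod_le_power_card T_le) auto
    then show ?thesis using card_Y[OF x(1)] by (simp add: i_def b_def)
  qed
  have X_sub: "X \<subseteq> (\<Union>(i, b)\<in>?P. Y i b)"
  proof
    fix a assume "a \<in> X"
    then have a: "a \<in> {p..k} \<rightarrow>\<^sub>E UNIV" "\<exists>i. i \<in> {p..k} \<and> a i \<noteq> 0"
      and "\<exists>W. \<forall>i\<in>{p..k}. a i \<noteq> 0 \<longrightarrow> (*) (a i) ` U i = W"
      unfolding X_def mem_Collect_eq Bex_def by simp_all
    then obtain W where W: "\<forall>i\<in>{p..k}. a i \<noteq> 0 \<longrightarrow> (*) (a i) ` U i = W" by (elim exE)
    define i where "i = (LEAST i. i \<in> {p..k} \<and> a i \<noteq> 0)"
    have i: "i \<in> {p..k}" "a i \<noteq> 0" using LeastI_ex[OF a(2)] by (auto simp: i_def)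
    have least: "a j = 0" if "j \<in> {p..k}" "j < i" for j
      using not_less_Least[of j "\<lambda>i. i \<in> {p..k} \<and> a i \<noteq> 0"] that by (auto simp: i_def)
    have Wi: "(*) (a i) ` U i = W" using W i by simp
    have "a j \<in> T W j" if "j \<in> {p..k}" for j
    proof (cases "a j = 0")
      case True
      \<comment> \<open>A zero entry scales \<open>U j\<close> into \<open>{0}\<close>, so it
        belongs to \<open>T W j\<close> as soon as \<open>W\<close> contains 0.\<close>
      have "0 \<in> W"
      proof -
        have "U i \<noteq> {}" using card[OF i(1)] d by auto
        then obtain u where "u \<in> U i" by blast
        then have "0 \<in> U i" using diff[OF i(1), of u u] by simp
        then show ?thesis using Wi by force
      qed
      then show ?thesis using True by (auto simp: T_def)
    qed (use W that in \<open>auto simp: T_def\<close>)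
    then have "a \<in> Y i (a i)" using a(1) least Wi by (simp add: Y_def PiE_iff)
    then show "a \<in> (\<Union>(i, b)\<in>?P. Y i b)" using i by blast
  qed
  have "card X \<le> card (\<Union>(i, b)\<in>?P. Y i b)"
    by (rule card_mono[OF _ X_sub]) (auto simp: Y_def intro!: finite_PiE fin)
  also have "\<dots> \<le> (\<Sum>(i, b)\<in>?P. card (Y i b))"
    using card_UN_le[of ?P "\<lambda>(i, b). Y i b"] by (simp add: case_prod_unfold)
  finally have X_le: "card X \<le> (\<Sum>(i, b)\<in>?P. card (Y i b))" .
  have sum_le: "(\<Sum>(i, b)\<in>?P. card (Y i b)) \<le> (\<Sum>(i, b)\<in>?P. Q ^ (k - i))"
    unfolding case_prod_unfold by (intro sum_mono Y_le)
  have "(\<Sum>(i, b)\<in>?P. Q ^ (k - i)) = (\<Sum>i\<in>{p..k}. (card (UNIV :: 'a set) - 1) * Q ^ (k - i))"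
    by (subst sum.cartesian_product[symmetric]) simp
  also have "\<dots> = (card (UNIV :: 'a set) - 1) * (\<Sum>i\<in>{p..k}. Q ^ (k - i))"
    by (simp add: sum_distrib_left)
  also have "(\<Sum>i\<in>{p..k}. Q ^ (k - i)) = (\<Sum>i<k - p + 1. Q ^ i)"
    using pk by (intro sum.reindex_bij_witness[of _ "\<lambda>i. k - i" "\<lambda>i. k - i"]) auto
  finally have total: "(\<Sum>(i, b)\<in>?P. Q ^ (k - i)) = (card (UNIV :: 'a set) - 1) * (\<Sum>i<k - p + 1. Q ^ i)" .
  show "card X \<le> (card (UNIV :: 'a set) - 1) * (\<Sum>i<k - p + 1. Q ^ i)"
    using X_le sum_le total by simp
  assume eq: "card X = (card (UNIV :: 'a set) - 1) * (\<Sum>i<k - p + 1. Q ^ i)" and j: "j \<in> {p<..k}"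
  \<comment> \<open>Equality of the totals forces equality in every summand of \<open>Y_le\<close>.
    The summand at \<open>(p, 1)\<close> is the relevant one: there the target space
    \<open>b U i\<close> is \<open>U p\<close> itself.\<close>
  have "(\<Sum>x\<in>?P. card (Y (fst x) (snd x))) = (\<Sum>x\<in>?P. Q ^ (k - fst x))"
    using X_le sum_le total eq by (simp add: case_prod_unfold)
  then have "card (Y (fst (p, 1::'a)) (snd (p, 1::'a))) = Q ^ (k - fst (p, 1::'a))"
    using pk by (intro sum_mono_inv[where i = "(p, 1)" and I = ?P and f = "\<lambda>x. card (Y (fst x) (snd x))"
          and g = "\<lambda>x. Q ^ (k - fst x)"] Y_le) simp_all
  then have prod_eq: "(\<Prod>j\<in>{p<..k}. card (T (U p) j)) = Q ^ (k - p)"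
    using card_Y[of p 1] pk by simp
  have le: "card (T (U p) i) \<le> Q" if "i \<in> {p<..k}" for i
    using T_le[of 1 p i] that pk by simp
  have "card (T (U p) j) = Q"
  \<comment> \<open>A product of \<open>k - p\<close> factors, each at most \<open>Q\<close>, would
    fall below \<open>Q ^ (k - p)\<close> if one factor were smaller than \<open>Q\<close>.\<close>
  proof (rule ccontr)
    assume "card (T (U p) j) \<noteq> Q"
    then have lt: "card (T (U p) j) < Q" using le[OF j] by simp
    have "(\<Prod>j\<in>{p<..k}. card (T (U p) j)) = card (T (U p) j) * (\<Prod>j\<in>{p<..k} - {j}. card (T (U p) j))"
      using j by (simp add: prod.remove)
    also have "\<dots> \<le> card (T (U p) j) * Q ^ card ({p<..k} - {j})"
      by (intro mult_left_mono prod_le_power_card le) auto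
    also have "\<dots> < Q * Q ^ card ({p<..k} - {j})" using lt Q by simp
    also have "\<dots> = Q ^ (k - p)"
    proof -
      have "k - p = Suc (card ({p<..k} - {j}))" using j by (simp add: Suc_diff_Suc)
      then show ?thesis by simp
    qed
    finally show False using prod_eq by simp
  qed
  then show "card {c. (*) c ` U j \<subseteq> U p} = Q" by (simp add: T_def)
qed

text \<open>Having more than one scalar guarantees a nonzero one, \<open>b\<close>, and
  \<open>b U = W\<close> by counting. Then \<open>c \<mapsto> c b\<close> is a bijection from the
  stabilizer of \<open>W\<close> to the scalars mapping \<open>U\<close> into
  \<open>W\<close>.\<close>

lemma scalars_into_eq_stabilizer:
  fixes U W :: "'a::{field,finite} set"
  assumes "card U = card W" and T: "card {c. (*) c ` U \<subseteq> W} > 1"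
  obtains b where "b \<noteq> 0" "(*) b ` U = W" "card {c. (*) c ` W \<subseteq> W} = card {c. (*) c ` U \<subseteq> W}"
proof -
  have "\<not> {c. (*) c ` U \<subseteq> W} \<subseteq> {0}"
    using T card_mono[of "{0}" "{c. (*) c ` U \<subseteq> W}"] by auto
  then obtain b where b: "b \<noteq> 0" "(*) b ` U \<subseteq> W" by blast
  then have img: "(*) b ` U = W" using assms(1) by (intro image_scale_eq_of_subset) auto
  have "(\<lambda>c. c * b) ` {c. (*) c ` W \<subseteq> W} = {c. (*) c ` U \<subseteq> W}"
  proof
    show "(\<lambda>c. c * b) ` {c. (*) c ` W \<subseteq> W} \<subseteq> {c. (*) c ` U \<subseteq> W}"
      using b(2) by (force simp: image_subset_iff mult.assoc)
    show "{c. (*) c ` U \<subseteq> W} \<subseteq> (\<lambda>c. c * b) ` {c. (*) c ` W \<subseteq> W}"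
    proof
      fix c assume "c \<in> {c. (*) c ` U \<subseteq> W}"
      then have "c / b \<in> {c. (*) c ` W \<subseteq> W}"
        using b(1) unfolding img[symmetric] by (auto simp: image_subset_iff)
      then show "c \<in> (\<lambda>c. c * b) ` {c. (*) c ` W \<subseteq> W}"
        using b(1) by (intro image_eqI[of _ _ "c / b"]) auto
    qed
  qed
  moreover have "inj_on (\<lambda>c. c * b) {c. (*) c ` W \<subseteq> W}" using b(1) by (auto simp: inj_on_def)
  ultimately have "card {c. (*) c ` W \<subseteq> W} = card {c. (*) c ` U \<subseteq> W}"
    by (metis card_image)
  with b(1) img show thesis by (rule that)
qed

text \<open>Both the whole field and \<open>U\<close> are vector spaces over the stabilizer, of
  dimensions \<open>r\<close> and \<open>a\<close>, say. Counting gives \<open>m = (m - d) r\<close>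
  and \<open>d = (m - d) a\<close>; subtracting, \<open>r = a + 1\<close>, so \<open>U\<close> has
  codimension 1. Positivity of \<open>d\<close> gives \<open>a > 0\<close> and hence
  \<open>r > 1\<close>.\<close>

lemma hyperplane_over_stabilizer:
  fixes K U :: "'a::{field,finite} set"
  assumes K: "subfield K class_ring" and q: "card (UNIV :: 'a set) = card K ^ m" and d: "0 < d" "d < m"
    and zero: "0 \<in> U" and diff: "\<And>x y. x \<in> U \<Longrightarrow> y \<in> U \<Longrightarrow> x - y \<in> U"
    and U: "card U = card K ^ d" and L: "card {c. (*) c ` U \<subseteq> U} = card K ^ (m - d)"
  obtains r where "r > 1" "m = r * (m - d)" "d = (r - 1) * (m - d)"
    "subfield {c. (*) c ` U \<subseteq> U} class_ring" "hyperplane_over {c. (*) c ` U \<subseteq> U} U"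
proof -
  let ?L = "{c. (*) c ` U \<subseteq> U}"
  have sub: "subfield ?L class_ring" by (intro subfield_stabilizer diff zero)
  have add: "x + y \<in> U" if "x \<in> U" "y \<in> U" for x y
    using diff[OF that(1) diff[OF zero that(2)]] by simp
  obtain r where r: "ring.dimension class_ring r ?L UNIV"
    using dimension_of_closed[OF sub, of UNIV] by auto
  have "\<exists>a. ring.dimension class_ring a ?L U"
    by (rule dimension_of_closed[OF sub zero]) (auto intro: add)
  then obtain a where a: "ring.dimension class_ring a ?L U" ..
  have q1: "card K > 1" by (rule card_subfield_gt_1[OF K])
  have "card K ^ m = card K ^ ((m - d) * r)"
    using card_dimension[OF sub r] q L by (simp add: power_mult)
  then have m: "m = (m - d) * r" using q1 by simp
  have "card K ^ d = card K ^ ((m - d) * a)"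
    using card_dimension[OF sub a] U L by (simp add: power_mult)
  then have da: "d = (m - d) * a" using q1 by simp
  have "(m - d) * (a + 1) = d + (m - d)" by (simp add: distrib_left da[symmetric])
  then have "(m - d) * r = (m - d) * (a + 1)" using m d by simp
  then have ra: "r = a + 1" using d by (simp only: mult_cancel1) simp
  have "a > 0" using da d by (cases a) auto
  have "hyperplane_over ?L U" unfolding hyperplane_over_def
    using r a ra by (intro exI[of _ r]) auto
  then show thesis
    using that[of r] m da ra \<open>a > 0\<close> sub by (simp add: mult.commute)
qed

subsection \<open>Row multiplication and the general linear group\<close>

text \<open>This connects spans, which are taken of lists, with matrices: a coefficient list becomes
  a column that is paired with \<open>v\<close>.\<close>

lemma mem_Span_list_of_vec:
  fixes K :: "'a::field set"
  assumes K: "subfield K class_ring"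
  shows "x \<in> ring.Span class_ring K (list_of_vec v) \<longleftrightarrow>
    (\<exists>c \<in> carrier_vec (dim_vec v). (\<forall>j<dim_vec v. c $ j \<in> K) \<and> x = c \<bullet> v)"
proof
  assume "x \<in> ring.Span class_ring K (list_of_vec v)"
  then obtain f where f: "\<forall>j<dim_vec v. f j \<in> K" "x = (\<Sum>j<dim_vec v. f j * v $ j)"
    unfolding mem_Span_iff[OF K] by (auto simp: list_of_vec_index)
  then show "\<exists>c \<in> carrier_vec (dim_vec v). (\<forall>j<dim_vec v. c $ j \<in> K) \<and> x = c \<bullet> v"
    by (intro bexI[of _ "vec (dim_vec v) f"]) (auto simp: scalar_prod_def lessThan_atLeast0)
next
  assume "\<exists>c \<in> carrier_vec (dim_vec v). (\<forall>j<dim_vec v. c $ j \<in> K) \<and> x = c \<bullet> v"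
  then obtain c where "\<forall>j<dim_vec v. c $ j \<in> K" "x = c \<bullet> v" by blast
  then show "x \<in> ring.Span class_ring K (list_of_vec v)"
    unfolding mem_Span_iff[OF K]
    by (intro exI[of _ "\<lambda>j. c $ j"]) (auto simp: list_of_vec_index scalar_prod_def lessThan_atLeast0)
qed

lemma independent_scalar_prod_eq_0:
  fixes K :: "'a::field set"
  assumes K: "subfield K class_ring" and ind: "ring.independent class_ring K (list_of_vec v)"
    and c: "c \<in> carrier_vec (dim_vec v)" "\<And>j. j < dim_vec v \<Longrightarrow> c $ j \<in> K" "c \<bullet> v = 0"
  shows "c = 0\<^sub>v (dim_vec v)"
proof -
  have len: "length (list_of_vec c) = length (list_of_vec v)" using c(1) by simp
  have "set (list_of_vec c) \<subseteq> K"
    using c(1,2) by (auto simp: in_set_conv_nth list_of_vec_index)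
  moreover have "ring.combine class_ring (list_of_vec c) (list_of_vec v) = \<zero>\<^bsub>class_ring\<^esub>"
    using c(3) by (simp add: combine_class_ring[OF len] list_of_vec_index scalar_prod_def lessThan_atLeast0)
  ultimately have "set (take (length (list_of_vec v)) (list_of_vec c)) \<subseteq> {\<zero>\<^bsub>class_ring\<^esub>}"
    by (rule ring.independent_imp_trivial_combine[OF class_ring.ring_axioms K ind])
  then have "list_of_vec c ! j = 0" if "j < dim_vec v" for j
    using nth_mem[of j "list_of_vec c"] len that by auto
  then show ?thesis using c(1) by (intro eq_vecI) (auto simp: list_of_vec_index)
qed

lemma row_mult_carrier [simp]: "A \<in> carrier_mat n m \<Longrightarrow> row_mult v A \<in> carrier_vec m"
  unfolding row_mult_def by (rule carrier_vecI) auto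

lemma dim_row_mult [simp]: "dim_vec (row_mult v A) = dim_col A"
  by (simp add: row_mult_def)

lemma index_row_mult: "j < dim_col A \<Longrightarrow> row_mult v A $ j = col A j \<bullet> v"
  by (simp add: row_mult_def)

lemma row_mult_mult:
  assumes "v \<in> carrier_vec n" "A \<in> carrier_mat n m" "B \<in> carrier_mat m p"
  shows "row_mult (row_mult v A) B = row_mult v (A * B)"
  using assms by (simp add: row_mult_def transpose_mult)

lemma row_mult_one [simp]: "v \<in> carrier_vec n \<Longrightarrow> row_mult v (1\<^sub>m n) = v"
  by (simp add: row_mult_def)

lemma row_mult_add:
  assumes "A \<in> carrier_mat n m" "v \<in> carrier_vec n" "w \<in> carrier_vec n"
  shows "row_mult (v + w) A = row_mult v A + row_mult w A"
  using assms unfolding row_mult_def by (intro mult_add_distrib_mat_vec[of _ m n]) auto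

lemma row_mult_smult:
  assumes "A \<in> carrier_mat n m" "v \<in> carrier_vec n"
  shows "row_mult (c \<cdot>\<^sub>v v) A = c \<cdot>\<^sub>v row_mult v A"
  using assms unfolding row_mult_def by (intro mult_mat_vec[of _ m n]) auto

section \<open>Invertible matrices over the subfield and change of basis\<close>

lemma GL_over_D:
  assumes "A \<in> GL_over n K"
  shows "A \<in> carrier_mat n n" "elements_mat A \<subseteq> K"
    and "\<exists>B \<in> GL_over n K. A * B = 1\<^sub>m n \<and> B * A = 1\<^sub>m n"
proof -
  show "A \<in> carrier_mat n n" "elements_mat A \<subseteq> K" using assms by (auto simp: GL_over_def)
  from assms obtain B where "B \<in> carrier_mat n n" "elements_mat B \<subseteq> K" "A \<in> carrier_mat n n"
    "elements_mat A \<subseteq> K" "inverts_mat A B" "inverts_mat B A"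
    by (auto simp: GL_over_def)
  then show "\<exists>B \<in> GL_over n K. A * B = 1\<^sub>m n \<and> B * A = 1\<^sub>m n"
    by (intro bexI[of _ B]) (auto simp: GL_over_def inverts_mat_def)
qed

lemma GL_over_I:
  assumes "A \<in> carrier_mat n n" "elements_mat A \<subseteq> K" "B \<in> carrier_mat n n" "elements_mat B \<subseteq> K"
    "A * B = 1\<^sub>m n" "B * A = 1\<^sub>m n"
  shows "A \<in> GL_over n K"
  using assms unfolding GL_over_def inverts_mat_def by auto

lemma elements_mat_mult_subset:
  fixes K :: "'a::field set"
  assumes K: "subfield K class_ring" and "A \<in> carrier_mat n m" "B \<in> carrier_mat m p"
    and "elements_mat A \<subseteq> K" "elements_mat B \<subseteq> K"
  shows "elements_mat (A * B) \<subseteq> K"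
proof
  fix x assume "x \<in> elements_mat (A * B)"
  then obtain i j where ij: "i < n" "j < p" "x = (A * B) $$ (i, j)" using assms(2,3) by auto
  have "A $$ (i, l) \<in> K" "B $$ (l, j) \<in> K" if "l < m" for l
    using ij that assms elements_matI[of A n m i l] elements_matI[of B m p l j] by auto
  then show "x \<in> K"
    using ij assms(2,3)
    by (auto simp: scalar_prod_def intro!: subfield_class_ring_sum[OF K] subfield_class_ring_closed(4)[OF K])
qed

lemma elements_one_mat_subset:
  fixes K :: "'a::field set"
  assumes K: "subfield K class_ring"
  shows "elements_mat (1\<^sub>m n :: 'a mat) \<subseteq> K"
  by (auto dest!: elements_matD simp: subfield_class_ring_closed[OF K])

lemma one_in_GL_over:
  fixes K :: "'a::field set"
  assumes "subfield K class_ring"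
  shows "1\<^sub>m n \<in> GL_over n K"
  by (rule GL_over_I[of _ _ _ "1\<^sub>m n"]) (auto simp: elements_one_mat_subset[OF assms, THEN subsetD])

lemma mult_in_GL_over:
  fixes K :: "'a::field set"
  assumes K: "subfield K class_ring" and A: "A \<in> GL_over n K" and B: "B \<in> GL_over n K"
  shows "A * B \<in> GL_over n K"
proof -
  obtain A' where A': "A' \<in> GL_over n K" "A * A' = 1\<^sub>m n" "A' * A = 1\<^sub>m n" using GL_over_D(3)[OF A] by blast
  obtain B' where B': "B' \<in> GL_over n K" "B * B' = 1\<^sub>m n" "B' * B = 1\<^sub>m n" using GL_over_D(3)[OF B] by blast
  note c = GL_over_D(1)[OF A] GL_over_D(1)[OF B] GL_over_D(1)[OF A'(1)] GL_over_D(1)[OF B'(1)]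
  note e = GL_over_D(2)[OF A] GL_over_D(2)[OF B] GL_over_D(2)[OF A'(1)] GL_over_D(2)[OF B'(1)]
  have "(A * B) * (B' * A') = A * (B * (B' * A'))"
    by (rule assoc_mult_mat[OF c(1,2) mult_carrier_mat[OF c(4,3)]])
  also have "B * (B' * A') = A'"
    using c(3) by (simp only: assoc_mult_mat[OF c(2,4,3), symmetric] B'(2) left_mult_one_mat[OF c(3)])
  finally have 1: "(A * B) * (B' * A') = 1\<^sub>m n" using A'(2) by simp
  have "(B' * A') * (A * B) = B' * (A' * (A * B))"
    by (rule assoc_mult_mat[OF c(4,3) mult_carrier_mat[OF c(1,2)]])
  also have "A' * (A * B) = B"
    by (simp only: assoc_mult_mat[OF c(3,1,2), symmetric] A'(3) left_mult_one_mat[OF c(2)])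
  finally have 2: "(B' * A') * (A * B) = 1\<^sub>m n" using B'(3) by simp
  show ?thesis
    by (rule GL_over_I[OF mult_carrier_mat[OF c(1,2)] elements_mat_mult_subset[OF K c(1,2) e(1,2)]
          mult_carrier_mat[OF c(4,3)] elements_mat_mult_subset[OF K c(4,3) e(4,3)] 1 2])
qed

text \<open>Column \<open>j\<close> of \<open>A\<close> holds the coordinates over \<open>K\<close>
  of the entry \<open>w $ j\<close> with respect to the entries of \<open>v\<close>.\<close>

lemma row_mult_solvable:
  fixes K :: "'a::field set"
  assumes K: "subfield K class_ring" and v: "v \<in> carrier_vec d" and w: "w \<in> carrier_vec d'"
    and sub: "set (list_of_vec w) \<subseteq> ring.Span class_ring K (list_of_vec v)"
  obtains A where "A \<in> carrier_mat d d'" "elements_mat A \<subseteq> K" "row_mult v A = w"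
proof -
  have "\<exists>c \<in> carrier_vec d. (\<forall>i<d. c $ i \<in> K) \<and> w $ j = c \<bullet> v" if "j < d'" for j
  proof -
    have "w $ j \<in> set (list_of_vec w)" using w that nth_mem[of j "list_of_vec w"] by (simp add: list_of_vec_index)
    then show ?thesis using sub mem_Span_list_of_vec[OF K, of "w $ j" v] v by auto
  qed
  then obtain c where c: "\<And>j. j < d' \<Longrightarrow> c j \<in> carrier_vec d" "\<And>i j. j < d' \<Longrightarrow> i < d \<Longrightarrow> c j $ i \<in> K"
    "\<And>j. j < d' \<Longrightarrow> w $ j = c j \<bullet> v" by metis
  let ?A = "mat d d' (\<lambda>(i, j). c j $ i)"
  have "col ?A j = c j" if "j < d'" for j
    using that carrier_vecD[OF c(1)[OF that]] by (intro eq_vecI) auto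
  then have "row_mult v ?A = w" using w c(3) by (intro eq_vecI) (auto simp: index_row_mult)
  moreover have "elements_mat ?A \<subseteq> K" using c(2) by (auto dest!: elements_matD)
  ultimately show thesis by (intro that[of ?A]) auto
qed

text \<open>The difference of column \<open>j\<close> of \<open>A\<close> and the unit vector has
  entries in \<open>K\<close> and pairs to 0 with \<open>v\<close>; independence makes it
  vanish.\<close>

lemma row_mult_independent_eq_one:
  fixes K :: "'a::field set"
  assumes K: "subfield K class_ring" and v: "v \<in> carrier_vec d"
    and ind: "ring.independent class_ring K (list_of_vec v)"
    and A: "A \<in> carrier_mat d d" "elements_mat A \<subseteq> K" and eq: "row_mult v A = v"
  shows "A = 1\<^sub>m d"
proof (rule mat_col_eqI)
  fix j assume "j < dim_col (1\<^sub>m d :: 'a mat)"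
  then have j: "j < d" by simp
  let ?c = "col A j - unit_vec d j"
  have "?c = 0\<^sub>v (dim_vec v)"
  proof (rule independent_scalar_prod_eq_0[OF K ind])
    show "?c \<in> carrier_vec (dim_vec v)" using v by (intro carrier_vecI) simp
    show "?c $ i \<in> K" if "i < dim_vec v" for i
    proof -
      have "A $$ (i, j) \<in> K" using elements_matI[OF A(1) _ j refl, of i] A(2) that v by auto
      moreover have "- unit_vec d j $ i \<in> K"
        using that v by (auto simp: unit_vec_def subfield_class_ring_closed[OF K])
      ultimately have "A $$ (i, j) + - unit_vec d j $ i \<in> K" by (rule subfield_class_ring_closed(3)[OF K])
      then show ?thesis using A(1) v that j by simp
    qed
    have "col A j \<bullet> v = v $ j" using index_row_mult[of j A v] eq A(1) j by simp
    then show "?c \<bullet> v = 0" using A(1) v j by (subst minus_scalar_prod_distrib[of _ d]) auto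
  qed
  then have "?c = 0\<^sub>v d" using v by simp
  then have "?c $ i = 0" if "i < d" for i using that by simp
  then show "col A j = col (1\<^sub>m d) j" using A(1) j by (intro eq_vecI) auto
qed (use A in auto)

text \<open>Expressing each basis in the other gives \<open>A\<close> and \<open>B\<close> over
  \<open>K\<close>. The product in either order fixes a vector with independent entries and is
  therefore the identity.\<close>

lemma exists_change_of_basis:
  fixes K :: "'a::field set"
  assumes K: "subfield K class_ring" and v: "v \<in> carrier_vec d" and w: "w \<in> carrier_vec d"
    and ind: "ring.independent class_ring K (list_of_vec v)" "ring.independent class_ring K (list_of_vec w)"
    and Span: "ring.Span class_ring K (list_of_vec v) = ring.Span class_ring K (list_of_vec w)"
  obtains A where "A \<in> GL_over d K" "row_mult v A = w"
proof -
  obtain A where A: "A \<in> carrier_mat d d" "elements_mat A \<subseteq> K" "row_mult v A = w"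
    using row_mult_solvable[OF K v w] Span_closed(5)[OF K, of "list_of_vec w"] Span by metis
  obtain B where B: "B \<in> carrier_mat d d" "elements_mat B \<subseteq> K" "row_mult w B = v"
    using row_mult_solvable[OF K w v] Span_closed(5)[OF K, of "list_of_vec v"] Span by metis
  have "A * B = 1\<^sub>m d"
    using A B by (intro row_mult_independent_eq_one[OF K v ind(1)] elements_mat_mult_subset[OF K])
      (auto simp: row_mult_mult[OF v, symmetric])
  moreover have "B * A = 1\<^sub>m d"
    using A B by (intro row_mult_independent_eq_one[OF K w ind(2)] elements_mat_mult_subset[OF K])
      (auto simp: row_mult_mult[OF w, symmetric])
  ultimately show thesis using A B by (intro that[of A] GL_over_I[of A d K B]) auto
qed

lemma Span_row_mult_subset:
  fixes K :: "'a::field set"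
  assumes K: "subfield K class_ring" and v: "v \<in> carrier_vec n"
    and A: "A \<in> carrier_mat n m" "elements_mat A \<subseteq> K"
  shows "ring.Span class_ring K (list_of_vec (row_mult v A)) \<subseteq> ring.Span class_ring K (list_of_vec v)"
proof -
  have "set (list_of_vec (row_mult v A)) \<subseteq> ring.Span class_ring K (list_of_vec v)"
  proof
    fix x assume "x \<in> set (list_of_vec (row_mult v A))"
    then obtain j where j: "j < m" "x = row_mult v A $ j"
      using A(1) by (auto simp: in_set_conv_nth list_of_vec_index)
    have "col A j $ i \<in> K" if "i < n" for i
      using elements_matI[OF A(1) that j(1) refl] A that j by auto
    then show "x \<in> ring.Span class_ring K (list_of_vec v)"
      unfolding mem_Span_list_of_vec[OF K] using j A(1) v
      by (intro bexI[of _ "col A j"]) (auto simp: index_row_mult)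
  qed
  then show ?thesis using scaled_Span_subset[OF K, of 1] by simp
qed

text \<open>Multiplication by a matrix over \<open>K\<close> cannot enlarge the span of the entries;
  applied to \<open>A\<close> and to its inverse, this leaves the span unchanged.\<close>

lemma rank_weight_row_mult:
  fixes K :: "'a::field set"
  assumes K: "subfield K class_ring" and v: "v \<in> carrier_vec n" and A: "A \<in> GL_over n K"
  shows "rank_weight K (row_mult v A) = rank_weight K v"
proof -
  obtain B where B: "B \<in> GL_over n K" "A * B = 1\<^sub>m n" using GL_over_D(3)[OF A] by blast
  note A' = GL_over_D(1,2)[OF A] and B' = GL_over_D(1,2)[OF B(1)]
  have "row_mult (row_mult v A) B = v"
    using row_mult_mult[OF v A'(1) B'(1)] B(2) v by simp
  then have "ring.Span class_ring K (list_of_vec (row_mult v A)) = ring.Span class_ring K (list_of_vec v)"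
    using Span_row_mult_subset[OF K v A'] Span_row_mult_subset[OF K _ B', of "row_mult v A"] A'(1)
    by (metis row_mult_carrier subset_antisym)
  then show ?thesis by (simp add: rank_weight_def)
qed

lemma inj_on_row_mult:
  assumes "A \<in> GL_over n K"
  shows "inj_on (\<lambda>c. row_mult c A) (carrier_vec n)"
proof -
  obtain B where B: "B \<in> GL_over n K" "A * B = 1\<^sub>m n" using GL_over_D(3)[OF assms] by blast
  then have "row_mult (row_mult c A) B = c" if "c \<in> carrier_vec n" for c
    using row_mult_mult[OF that GL_over_D(1)[OF assms] GL_over_D(1)[OF B(1)]] that by simp
  then show ?thesis by (rule inj_on_inverseI)
qed

section \<open>Linear codes under equivalence\<close>

lemma linear_code_carrier: "linear_code n k C \<Longrightarrow> C \<subseteq> carrier_vec n"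
  unfolding linear_code_def VectorSpace.subspace_def submodule_def by (auto simp: module_vec_simps)

lemma finite_carrier_vec: "finite (carrier_vec n :: 'a::finite vec set)"
proof -
  have "carrier_vec n \<subseteq> vec_of_list ` {xs :: 'a list. set xs \<subseteq> UNIV \<and> length xs = n}"
    by (auto intro!: image_eqI[of _ _ "list_of_vec _"] simp: vec_list)
  then show ?thesis by (rule finite_subset) (intro finite_imageI finite_lists_length_eq, simp)
qed

text \<open>Right multiplication by an invertible matrix is linear and injective. It is interpreted
  first as a map into the full space, to see that the image is a subspace, and then as a map onto
  its image, to compare dimensions.\<close>

lemma linear_code_row_mult:
  fixes C :: "'a::{field,finite} vec set"
  assumes C: "linear_code n k C" and A: "A \<in> GL_over n K"
  shows "linear_code n k ((\<lambda>c. row_mult c A) ` C)"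
proof -
  let ?V = "module_vec TYPE('a) n" and ?T = "\<lambda>c. row_mult c A"
  note A' = GL_over_D(1)[OF A] and Cn = linear_code_carrier[OF C]
  interpret V: vectorspace class_ring ?V by (rule vec_vs)
  have sub: "VectorSpace.subspace class_ring C ?V"
    and dim: "vectorspace.dim class_ring (?V \<lparr>carrier := C\<rparr>) = k"
    using C by (simp_all add: linear_code_def)
  interpret C: vectorspace class_ring "?V \<lparr>carrier := C\<rparr>" by (rule V.subspace_is_vs[OF sub])
  have add: "?T (x + y) = ?T x + ?T y" if "x \<in> C" "y \<in> C" for x y
    using that Cn by (intro row_mult_add[OF A']) auto
  have smult: "?T (a \<cdot>\<^sub>v x) = a \<cdot>\<^sub>v ?T x" if "x \<in> C" for a x
    using that Cn by (intro row_mult_smult[OF A']) auto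
  interpret T: linear_map class_ring "?V \<lparr>carrier := C\<rparr>" ?V ?T
    by unfold_locales (use A' add smult in \<open>auto simp: module_hom_def module_vec_simps\<close>)
  have im: "T.im = ?T ` C" by (simp add: T.im_def)
  have sub': "VectorSpace.subspace class_ring (?T ` C) ?V" using T.imT_is_subspace im by simp
  interpret D: vectorspace class_ring "?V \<lparr>carrier := ?T ` C\<rparr>" by (rule V.subspace_is_vs[OF sub'])
  interpret T': linear_map class_ring "?V \<lparr>carrier := C\<rparr>" "?V \<lparr>carrier := ?T ` C\<rparr>" ?T
    by unfold_locales (use add smult in \<open>auto simp: module_hom_def module_vec_simps\<close>)
  have "finite C" using Cn finite_carrier_vec by (rule finite_subset)
  \<comment> \<open>The code is finite and spans itself.\<close>
  then have "C.fin_dim" unfolding C.fin_dim_def using C.in_own_span[of C] C.span_is_subset2[of C]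
    by (intro exI[of _ C]) auto
  then have "D.dim = k"
    using T'.dim_eq inj_on_subset[OF inj_on_row_mult[OF A] Cn] dim by simp
  then show ?thesis using sub' by (simp add: linear_code_def)
qed

subsection \<open>Block-diagonal matrices and punctured codes\<close>

lemma concat_vec_simps [simp]:
  "concat_vec [] = vNil" "concat_vec (v # vs) = v @\<^sub>v concat_vec vs"
  by (simp_all add: concat_vec_def)

lemma list_of_vec_concat_vec: "list_of_vec (concat_vec vs) = concat (map list_of_vec vs)"
  by (induction vs) auto

lemma dim_concat_vec: "dim_vec (concat_vec vs) = sum_list (map dim_vec vs)"
  by (induction vs) auto

lemma row_mult_append_four_block:
  assumes "A \<in> carrier_mat a b" "B \<in> carrier_mat c d" "v \<in> carrier_vec a" "w \<in> carrier_vec c"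
  shows "row_mult (v @\<^sub>v w) (four_block_mat A (0\<^sub>m a d) (0\<^sub>m c b) B) = row_mult v A @\<^sub>v row_mult w B"
proof -
  have "row_mult (v @\<^sub>v w) (four_block_mat A (0\<^sub>m a d) (0\<^sub>m c b) B) =
      four_block_mat A\<^sup>T (0\<^sub>m b c) (0\<^sub>m d a) B\<^sup>T *\<^sub>v (v @\<^sub>v w)"
    unfolding row_mult_def using assms by (subst transpose_four_block_mat) auto
  also have "\<dots> = (A\<^sup>T *\<^sub>v v + 0\<^sub>m b c *\<^sub>v w) @\<^sub>v (0\<^sub>m d a *\<^sub>v v + B\<^sup>T *\<^sub>v w)"
    using assms by (intro four_block_mat_mult_vec) auto
  also have "\<dots> = row_mult v A @\<^sub>v row_mult w B"
  proof -
    have "A\<^sup>T *\<^sub>v v \<in> carrier_vec b" "B\<^sup>T *\<^sub>v w \<in> carrier_vec d"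
      using assms by (auto intro: carrier_vecI)
    moreover have "0\<^sub>m b c *\<^sub>v w = 0\<^sub>v b" "0\<^sub>m d a *\<^sub>v v = 0\<^sub>v d"
      using assms by (auto intro!: eq_vecI)
    ultimately show ?thesis by (simp add: row_mult_def)
  qed
  finally show ?thesis .
qed

lemma row_mult_concat_diag_block:
  assumes "\<And>i. i \<in> set is \<Longrightarrow> dim_vec (x i) = dim_row (A i)"
  shows "row_mult (concat_vec (map x is)) (diag_block_mat (map A is)) =
    concat_vec (map (\<lambda>i. row_mult (x i) (A i)) is)"
  using assms
proof (induction "is")
  case Nil
  then show ?case by (intro eq_vecI) auto
next
  case (Cons i "is")
  let ?D = "diag_block_mat (map A is)"
  have "dim_vec (concat_vec (map x is)) = dim_row ?D"
    using Cons.prems by (simp add: dim_concat_vec dim_diag_block_mat comp_def cong: map_cong)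
  then have "row_mult (x i @\<^sub>v concat_vec (map x is))
      (four_block_mat (A i) (0\<^sub>m (dim_row (A i)) (dim_col ?D)) (0\<^sub>m (dim_row ?D) (dim_col (A i))) ?D) =
      row_mult (x i) (A i) @\<^sub>v row_mult (concat_vec (map x is)) ?D"
    using Cons.prems by (intro row_mult_append_four_block carrier_vecI) auto
  then show ?case using Cons by (simp add: Let_def)
qed

section \<open>Invertibility of block-diagonal matrices\<close>

lemma four_block_diag_mult_eq_one:
  fixes A :: "'a::field mat"
  assumes "A \<in> carrier_mat a a" "A' \<in> carrier_mat a a" "B \<in> carrier_mat b b" "B' \<in> carrier_mat b b"
    and "A * A' = 1\<^sub>m a" "B * B' = 1\<^sub>m b"
  shows "four_block_mat A (0\<^sub>m a b) (0\<^sub>m b a) B * four_block_mat A' (0\<^sub>m a b) (0\<^sub>m b a) B' = 1\<^sub>m (a + b)"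
proof -
  have "four_block_mat A (0\<^sub>m a b) (0\<^sub>m b a) B * four_block_mat A' (0\<^sub>m a b) (0\<^sub>m b a) B' =
      four_block_mat (A * A' + 0\<^sub>m a b * 0\<^sub>m b a) (A * 0\<^sub>m a b + 0\<^sub>m a b * B')
        (0\<^sub>m b a * A' + B * 0\<^sub>m b a) (0\<^sub>m b a * 0\<^sub>m a b + B * B')"
    by (rule mult_four_block_mat[of _ a a _ b _ b _ _ a _ b]) (use assms in auto)
  also have "\<dots> = four_block_mat (1\<^sub>m a) (0\<^sub>m a b) (0\<^sub>m b a) (1\<^sub>m b)"
    using assms by simp
  also have "\<dots> = 1\<^sub>m (a + b)" by (intro eq_matI) auto
  finally show ?thesis .
qed

lemma four_block_diag_in_GL_over:
  fixes K :: "'a::field set"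
  assumes K: "subfield K class_ring" and A: "A \<in> GL_over a K" and B: "B \<in> GL_over b K"
  shows "four_block_mat A (0\<^sub>m a b) (0\<^sub>m b a) B \<in> GL_over (a + b) K"
proof -
  obtain A' where A': "A' \<in> GL_over a K" "A * A' = 1\<^sub>m a" "A' * A = 1\<^sub>m a" using GL_over_D(3)[OF A] by blast
  obtain B' where B': "B' \<in> GL_over b K" "B * B' = 1\<^sub>m b" "B' * B = 1\<^sub>m b" using GL_over_D(3)[OF B] by blast
  note c = GL_over_D(1)[OF A] GL_over_D(1)[OF B] GL_over_D(1)[OF A'(1)] GL_over_D(1)[OF B'(1)]
  have el: "elements_mat (four_block_mat X (0\<^sub>m a b) (0\<^sub>m b a) Y) \<subseteq> K"
    if "X \<in> GL_over a K" "Y \<in> GL_over b K" for X Y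
  proof -
    have "elements_mat (0\<^sub>m a b :: 'a mat) \<subseteq> K" "elements_mat (0\<^sub>m b a :: 'a mat) \<subseteq> K"
      using subfield_class_ring_closed(1)[OF K] elements_0_mat[of a b, where 'a = 'a]
        elements_0_mat[of b a, where 'a = 'a] by blast+
    then show ?thesis
      using elements_four_block_mat[OF GL_over_D(1)[OF that(1)] zero_carrier_mat zero_carrier_mat
          GL_over_D(1)[OF that(2)]] GL_over_D(2)[OF that(1)] GL_over_D(2)[OF that(2)]
      by (meson Un_least order_trans)
  qed
  show ?thesis
    by (rule GL_over_I[OF _ el[OF A B] _ el[OF A'(1) B'(1)]])
      (use c in \<open>auto intro!: four_block_diag_mult_eq_one A' B'\<close>)
qed

lemma diag_block_mat_in_GL_over:
  fixes K :: "'a::field set"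
  assumes K: "subfield K class_ring" and "\<And>i. i \<in> set is \<Longrightarrow> A i \<in> GL_over (d i) K"
  shows "diag_block_mat (map A is) \<in> GL_over (sum_list (map d is)) K"
  using assms(2)
proof (induction "is")
  case Nil
  \<comment> \<open>The empty block-diagonal matrix is the zero matrix of size 0, which is also the
    identity.\<close>
  have "1\<^sub>m 0 = (0\<^sub>m 0 0 :: 'a mat)" by (intro eq_matI) auto
  then show ?case using one_in_GL_over[OF K, of 0] by simp
next
  case (Cons i "is")
  have Ai: "A i \<in> GL_over (d i) K" and D: "diag_block_mat (map A is) \<in> GL_over (sum_list (map d is)) K"
    using Cons by auto
  show ?case
    using four_block_diag_in_GL_over[OF K Ai D] GL_over_D(1)[OF Ai] GL_over_D(1)[OF D]
    by (simp add: Let_def)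
qed

lemma row_mult_mat_of_row: "row_mult (vec 1 (\<lambda>_. a)) (mat_of_row u) = a \<cdot>\<^sub>v u"
  by (intro eq_vecI) (auto simp: row_mult_def scalar_prod_def)

text \<open>A message vector is cut into \<open>k\<close> pieces of length 1, one for each one-row
  block, so that the multiplication acts blockwise. This identifies a code in weight complementary
  form with the puncturing at \<open>t = 1\<close>.\<close>

lemma image_row_mult_blocks:
  "(\<lambda>x. row_mult x (diag_block_mat (map (\<lambda>i. mat_of_row (u i)) [1..<Suc k]))) ` carrier_vec k =
    punctured_code k u 1" (is "?F ` _ = _")
proof -
  let ?c = "\<lambda>a :: nat \<Rightarrow> 'a. concat_vec (map (\<lambda>i. vec 1 (\<lambda>_. a i)) [1..<Suc k])"
  have F: "?F (?c a) = concat_vec (map (\<lambda>i. a i \<cdot>\<^sub>v u i) [1..<Suc k])" for a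
    by (subst row_mult_concat_diag_block) (simp_all only: dim_vec mat_of_row_dim row_mult_mat_of_row)
  have list: "list_of_vec (?c a) = map a [1..<Suc k]" for a
  proof -
    have "list_of_vec (vec 1 (\<lambda>_. b)) = [b]" for b :: 'a
      by (simp add: list_of_vec_map)
    then show ?thesis by (simp only: list_of_vec_concat_vec map_map comp_def concat_map_singleton)
  qed
  have carrier: "?c a \<in> carrier_vec k" for a
    using arg_cong[OF list[of a], of length] by (intro carrier_vecI) simp
  have surj: "\<exists>a. x = ?c a" if "x \<in> carrier_vec k" for x
  proof (intro exI)
    \<comment> \<open>Blocks are numbered from 1 but vector entries from 0, hence
      \<open>i - 1\<close>.\<close>
    have "list_of_vec x = list_of_vec (?c (\<lambda>i. x $ (i - 1)))"
      unfolding list using that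
      by (intro nth_equalityI) (auto simp: list_of_vec_index simp del: upt_Suc)
    then show "x = ?c (\<lambda>i. x $ (i - 1))" by (metis vec_list)
  qed
  show ?thesis
  proof
    show "?F ` carrier_vec k \<subseteq> punctured_code k u 1"
    proof (rule image_subsetI)
      fix x :: "'a vec" assume "x \<in> carrier_vec k"
      then obtain a where "x = ?c a" using surj by blast
      then show "?F x \<in> punctured_code k u 1" using F[of a] unfolding punctured_code_def by blast
    qed
    show "punctured_code k u 1 \<subseteq> ?F ` carrier_vec k"
    proof
      fix y assume "y \<in> punctured_code k u 1"
      then obtain a where "y = ?F (?c a)" unfolding punctured_code_def F by blast
      then show "y \<in> ?F ` carrier_vec k" using carrier by blast
    qed
  qed
qed

text \<open>The nonzero factors \<open>g i\<close> are absorbed by the free coefficients: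
  \<open>a i\<close> becomes \<open>a i * g i\<close>, with inverse \<open>a i / g i\<close>. Blocks
  therefore have to be matched only up to scalars.\<close>

lemma punctured_code_change_blocks:
  assumes A: "\<And>i. i \<in> {t..k} \<Longrightarrow> A i \<in> carrier_mat (d i) (d i) \<and> v i \<in> carrier_vec (d i)"
    and u: "\<And>i. i \<in> {t..k} \<Longrightarrow> g i \<noteq> 0 \<and> row_mult (v i) (A i) = g i \<cdot>\<^sub>v u i"
  shows "(\<lambda>c. row_mult c (diag_block_mat (map A [t..<Suc k]))) ` punctured_code k v t = punctured_code k u t"
    (is "?F ` _ = _")
proof -
  let ?w = "\<lambda>u a. concat_vec (map (\<lambda>i. a i \<cdot>\<^sub>v u i) [t..<Suc k])"
  have F: "?F (?w v a) = ?w u (\<lambda>i. a i * g i)" for a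
  proof -
    have "?F (?w v a) = concat_vec (map (\<lambda>i. row_mult (a i \<cdot>\<^sub>v v i) (A i)) [t..<Suc k])"
    proof (rule row_mult_concat_diag_block)
      fix i assume "i \<in> set [t..<Suc k]"
      then have "i \<in> {t..k}" by auto
      from A[OF this] show "dim_vec (a i \<cdot>\<^sub>v v i) = dim_row (A i)" by auto
    qed
    also have "\<dots> = ?w u (\<lambda>i. a i * g i)"
    proof (intro arg_cong[where f = concat_vec] map_cong refl)
      fix i assume "i \<in> set [t..<Suc k]"
      then have i: "i \<in> {t..k}" by auto
      show "row_mult (a i \<cdot>\<^sub>v v i) (A i) = (a i * g i) \<cdot>\<^sub>v u i"
        using row_mult_smult[of "A i" "d i" "d i" "v i" "a i"] A[OF i] u[OF i]
        by (simp add: smult_smult_assoc)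
    qed
    finally show ?thesis .
  qed
  have G: "?w u a = ?F (?w v (\<lambda>i. a i / g i))" for a
    unfolding F using u
    by (intro arg_cong[where f = concat_vec] map_cong refl) (auto simp: less_Suc_eq_le)
  show ?thesis
  proof
    show "?F ` punctured_code k v t \<subseteq> punctured_code k u t"
    proof (rule image_subsetI)
      fix y assume "y \<in> punctured_code k v t"
      then obtain a where "y = ?w v a" unfolding punctured_code_def by blast
      then have "?F y = ?w u (\<lambda>i. a i * g i)" using F[of a] by simp
      then show "?F y \<in> punctured_code k u t"
        unfolding punctured_code_def by (intro CollectI exI[of _ "\<lambda>i. a i * g i"]) simp
    qed
    show "punctured_code k u t \<subseteq> ?F ` punctured_code k v t"
    proof
      fix y assume "y \<in> punctured_code k u t"
      then obtain a where "y = ?F (?w v (\<lambda>i. a i / g i))" unfolding punctured_code_def G by blast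
      moreover have "?w v (\<lambda>i. a i / g i) \<in> punctured_code k v t"
        unfolding punctured_code_def by (intro CollectI exI[of _ "\<lambda>i. a i / g i"]) simp
      ultimately show "y \<in> ?F ` punctured_code k v t" by blast
    qed
  qed
qed

lemma mem_listset_iff: "xs \<in> listset As \<longleftrightarrow> list_all2 (\<in>) xs As"
  by (induction As arbitrary: xs) (auto simp: set_Cons_def list_all2_Cons2)

lemma punctured_code_const:
  assumes "t \<le> k" and "\<And>i. i \<in> {t..k} \<Longrightarrow> u i = w"
  shows "punctured_code k u t = direct_sum_codes (replicate (k - t + 1) (line_code w))"
proof
  have map: "map (\<lambda>i. a i \<cdot>\<^sub>v u i) [t..<Suc k] = map (\<lambda>i. a i \<cdot>\<^sub>v w) [t..<Suc k]" for a
    using assms(2) by (intro map_cong) (auto simp: less_Suc_eq_le)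
  show "punctured_code k u t \<subseteq> direct_sum_codes (replicate (k - t + 1) (line_code w))"
  proof
    fix y assume "y \<in> punctured_code k u t"
    then obtain a where y: "y = concat_vec (map (\<lambda>i. a i \<cdot>\<^sub>v w) [t..<Suc k])"
      unfolding punctured_code_def map by blast
    have "map (\<lambda>i. a i \<cdot>\<^sub>v w) [t..<Suc k] \<in> listset (replicate (k - t + 1) (line_code w))"
      unfolding mem_listset_iff list_all2_conv_all_nth using assms(1)
      by (auto simp: line_code_def nth_append simp del: upt_Suc replicate.simps replicate_Suc)
    then show "y \<in> direct_sum_codes (replicate (k - t + 1) (line_code w))"
      unfolding direct_sum_codes_def y by (rule imageI)
  qed
  show "direct_sum_codes (replicate (k - t + 1) (line_code w)) \<subseteq> punctured_code k u t"
  proof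
    fix y assume "y \<in> direct_sum_codes (replicate (k - t + 1) (line_code w))"
    then obtain xs where y: "y = concat_vec xs" and "xs \<in> listset (replicate (k - t + 1) (line_code w))"
      unfolding direct_sum_codes_def by blast
    then have xs: "length xs = k - t + 1" "\<forall>j<k - t + 1. \<exists>b. xs ! j = b \<cdot>\<^sub>v w"
      unfolding mem_listset_iff list_all2_conv_all_nth line_code_def
      by (auto simp del: replicate.simps replicate_Suc)
    then obtain b where b: "\<And>j. j < k - t + 1 \<Longrightarrow> xs ! j = b j \<cdot>\<^sub>v w" by metis
    \<comment> \<open>List positions start at 0 and block indices at \<open>t\<close>.\<close>
    have "xs = map (\<lambda>i. b (i - t) \<cdot>\<^sub>v w) [t..<Suc k]"
      using xs(1) b assms(1) by (intro nth_equalityI) (auto simp del: upt_Suc)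
    then show "y \<in> punctured_code k u t"
      unfolding punctured_code_def mem_Collect_eq map y by (intro exI[of _ "\<lambda>i. b (i - t)"]) simp
  qed
qed

subsection \<open>Words of minimum weight\<close>

text \<open>The support \<open>W\<close> of a word with coefficients \<open>a\<close> contains every
  \<open>a i U i\<close>, which has \<open>card K ^ ns i\<close> elements if
  \<open>a i \<noteq> 0\<close>. Weight \<open>d\<close> thus forces zero coefficients on the longer
  blocks, and on blocks of length \<open>d\<close> the inclusion becomes equality by counting. So
  every such word comes from an aligned tuple, extended by 0.\<close>

lemma card_min_weight_words_le:
  fixes K :: "'a::{field,finite} set" and v :: "nat \<Rightarrow> 'a vec" and ns :: "nat \<Rightarrow> nat"
  defines "U \<equiv> \<lambda>i. ring.Span class_ring K (list_of_vec (v i))"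
  assumes K: "subfield K class_ring" and p: "1 \<le> p" and d: "0 < d"
    and card_U: "\<And>i. i \<in> {1..k} \<Longrightarrow> card (U i) = card K ^ ns i"
    and ns: "\<And>i. i \<in> {p..k} \<Longrightarrow> ns i = d" "\<And>i. i \<in> {1..<p} \<Longrightarrow> d < ns i"
  shows "card {c \<in> punctured_code k v 1. rank_weight K c = d} \<le>
    card {a \<in> {p..k} \<rightarrow>\<^sub>E UNIV. (\<exists>i\<in>{p..k}. a i \<noteq> 0) \<and>
      (\<exists>W. \<forall>i\<in>{p..k}. a i \<noteq> 0 \<longrightarrow> (*) (a i) ` U i = W)}" (is "card ?M \<le> card ?X")
proof -
  let ?w = "\<lambda>a. concat_vec (map (\<lambda>i. a i \<cdot>\<^sub>v v i) [1..<Suc k])"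
  have q1: "card K > 1" by (rule card_subfield_gt_1[OF K])
  have "?M \<subseteq> (\<lambda>a. ?w (\<lambda>i. if i \<in> {p..k} then a i else 0)) ` ?X"
  proof
    fix c assume "c \<in> ?M"
    then obtain a where c: "c = ?w a" and weight: "rank_weight K c = d"
      unfolding punctured_code_def by blast
    define W where "W = ring.Span class_ring K (list_of_vec c)"
    have card_W: "card W = card K ^ d"
      using card_Span[OF K, of "list_of_vec c"] weight by (simp add: W_def rank_weight_def)
    have entries: "set (list_of_vec c) = (\<Union>i\<in>{1..k}. (*) (a i) ` set (list_of_vec (v i)))"
    proof -
      have "list_of_vec (b \<cdot>\<^sub>v x) = map ((*) b) (list_of_vec x)" for b :: 'a and x
        by (simp add: list_of_vec_map)
      then show ?thesis
        by (simp add: c list_of_vec_concat_vec comp_def atLeastLessThanSuc_atLeastAtMost del: upt_Suc)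
    qed
    have sub: "(*) (a i) ` U i \<subseteq> W" if "i \<in> {1..k}" for i
      unfolding U_def W_def
      by (rule scaled_Span_subset[OF K]) (use entries that Span_closed(5)[OF K, of "list_of_vec c"] in blast)
    have card_aU: "card ((*) (a i) ` U i) = card K ^ ns i" if "i \<in> {1..k}" "a i \<noteq> 0" for i
      using card_U[OF that(1)] that(2) by (subst card_image) (auto simp: inj_on_def)
    have ns_le: "ns i \<le> d" if "i \<in> {1..k}" "a i \<noteq> 0" for i
    proof -
      have "card K ^ ns i \<le> card K ^ d"
        using card_mono[OF _ sub[OF that(1)]] card_aU[OF that] card_W by simp
      then show ?thesis using q1 by simp
    qed
    have zero: "a i = 0" if "i \<in> {1..<p}" "i \<le> k" for i
      using ns_le[of i] ns(2)[OF that(1)] that by force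
    have eq: "(*) (a i) ` U i = W" if "i \<in> {p..k}" "a i \<noteq> 0" for i
      using that p sub[of i] card_aU[of i] ns(1)[of i] card_W by (intro card_subset_eq) auto
    \<comment> \<open>With all coefficients 0 the support would be \<open>{0}\<close>, whereas it
      has \<open>card K ^ d > 1\<close> elements.\<close>
    have nonzero: "\<exists>i\<in>{p..k}. a i \<noteq> 0"
    proof (rule ccontr)
      assume "\<not> (\<exists>i\<in>{p..k}. a i \<noteq> 0)"
      then have "a i = 0" if "i \<in> {1..k}" for i using zero[of i] that by (cases "p \<le> i") auto
      then have "set (list_of_vec c) \<subseteq> {0}" using entries by auto
      then have "list_of_vec c ! j = 0" if "j < length (list_of_vec c)" for j
        using nth_mem[OF that] by blast
      then have "x = 0" if "x \<in> W" for x
        using that unfolding W_def mem_Span_iff[OF K] by auto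
      then have "W \<subseteq> {0}" by blast
      then have "card W \<le> 1" using card_mono[of "{0}" W] by simp
      then show False using card_W q1 d one_less_power[of "card K" d] by simp
    qed
    have "restrict a {p..k} \<in> ?X"
      using nonzero eq by (auto intro!: exI[of _ W])
    \<comment> \<open>Outside \<open>{p..k}\<close> the restricted tuple is
      \<open>undefined\<close>; the conditional puts the required 0 there.\<close>
    moreover have "c = ?w (\<lambda>i. if i \<in> {p..k} then restrict a {p..k} i else 0)"
      unfolding c
    proof (intro arg_cong[where f = concat_vec] map_cong refl)
      fix i assume "i \<in> set [1..<Suc k]"
      then have "i \<in> {1..k}" by auto
      then show "a i \<cdot>\<^sub>v v i = (if i \<in> {p..k} then restrict a {p..k} i else 0) \<cdot>\<^sub>v v i"
        using zero[of i] by (cases "p \<le> i") auto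
    qed
    ultimately show "c \<in> (\<lambda>a. ?w (\<lambda>i. if i \<in> {p..k} then a i else 0)) ` ?X" by (intro image_eqI[where x = "restrict a {p..k}"])
  qed
  moreover have "finite ?X" by (rule finite_subset[of _ "{p..k} \<rightarrow>\<^sub>E UNIV"]) (auto intro: finite_PiE)
  ultimately show ?thesis by (rule surj_card_le[rotated])
qed

text \<open>Right multiplication by \<open>A\<close> is injective and preserves the rank weight, so
  words of weight \<open>i\<close> inject into words of weight \<open>i\<close>.\<close>

lemma weight_count_equivalent_le:
  fixes K :: "'a::{field,finite} set"
  assumes K: "subfield K class_ring" and A: "A \<in> GL_over n K" and C: "C \<subseteq> carrier_vec n"
  shows "weight_count K C i \<le> weight_count K ((\<lambda>c. row_mult c A) ` C) i"
  unfolding weight_count_def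
proof (rule card_inj_on_le)
  show "inj_on (\<lambda>c. row_mult c A) {c \<in> C. rank_weight K c = i}"
    using C by (intro inj_on_subset[OF inj_on_row_mult[OF A]]) auto
  show "(\<lambda>c. row_mult c A) ` {c \<in> C. rank_weight K c = i} \<subseteq>
      {c \<in> (\<lambda>c. row_mult c A) ` C. rank_weight K c = i}"
    using C by (auto simp: rank_weight_row_mult[OF K _ A])
  have "(\<lambda>c. row_mult c A) ` C \<subseteq> carrier_vec n"
    using row_mult_carrier[OF GL_over_D(1)[OF A]] by auto
  then show "finite {c \<in> (\<lambda>c. row_mult c A) ` C. rank_weight K c = i}"
    using finite_carrier_vec[of n] by (auto intro: finite_subset)
qed

text \<open>The entries of \<open>b v\<close> span the same space as those of \<open>w\<close> and
  are equally many, so they too are independent by counting. A change of basis takes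
  \<open>b v\<close> to \<open>w\<close>; dividing by \<open>b\<close> gives the claim for
  \<open>v\<close>.\<close>

lemma exists_scaled_change_of_basis:
  fixes K :: "'a::{field,finite} set"
  assumes K: "subfield K class_ring" and vw: "v \<in> carrier_vec d" "w \<in> carrier_vec d"
    and ind: "ring.independent class_ring K (list_of_vec w)"
    and b: "b \<noteq> 0" "(*) b ` ring.Span class_ring K (list_of_vec v) = ring.Span class_ring K (list_of_vec w)"
  obtains A where "A \<in> GL_over d K" "row_mult v A = inverse b \<cdot>\<^sub>v w"
proof -
  let ?U = "ring.Span class_ring K (list_of_vec v)" and ?W = "ring.Span class_ring K (list_of_vec w)"
  have map: "list_of_vec (c \<cdot>\<^sub>v x) = map ((*) c) (list_of_vec x)" for c :: 'a and x
    by (simp add: list_of_vec_map)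
  have "ring.Span class_ring K (list_of_vec (b \<cdot>\<^sub>v v)) = (*) b ` ?U"
  proof
    have "(*) b ` set (list_of_vec v) \<subseteq> (*) b ` ?U" using Span_closed(5)[OF K, of "list_of_vec v"] by blast
    then have "(*) 1 ` ring.Span class_ring K (list_of_vec (b \<cdot>\<^sub>v v)) \<subseteq> ?W"
      unfolding b(2) by (intro scaled_Span_subset[OF K]) (simp add: map)
    then show "ring.Span class_ring K (list_of_vec (b \<cdot>\<^sub>v v)) \<subseteq> (*) b ` ?U" unfolding b(2) by simp
    show "(*) b ` ?U \<subseteq> ring.Span class_ring K (list_of_vec (b \<cdot>\<^sub>v v))"
      using Span_closed(5)[OF K, of "list_of_vec (b \<cdot>\<^sub>v v)"] by (intro scaled_Span_subset[OF K]) (simp add: map)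
  qed
  then have Span: "ring.Span class_ring K (list_of_vec (b \<cdot>\<^sub>v v)) = ?W" using b(2) by simp
  have "card ?W = card K ^ length (list_of_vec w)"
    by (rule card_dimension[OF K ring.dimension_independent[OF class_ring.ring_axioms ind]])
  then have "card (ring.Span class_ring K (list_of_vec (b \<cdot>\<^sub>v v))) = card K ^ length (list_of_vec (b \<cdot>\<^sub>v v))"
    unfolding Span using vw by simp
  then have "ring.independent class_ring K (list_of_vec (b \<cdot>\<^sub>v v))" by (rule independent_of_card_Span[OF K])
  then obtain A where A: "A \<in> GL_over d K" "row_mult (b \<cdot>\<^sub>v v) A = w"
    using exists_change_of_basis[OF K smult_carrier_vec[THEN iffD2, OF vw(1)] vw(2) _ ind Span] by blast
  have "b \<cdot>\<^sub>v row_mult v A = w" using A(2) row_mult_smult[OF GL_over_D(1)[OF A(1)] vw(1)] by simp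
  then have "inverse b \<cdot>\<^sub>v w = (inverse b * b) \<cdot>\<^sub>v row_mult v A"
    by (auto simp: smult_smult_assoc)
  then show thesis using A(1) b(1) by (intro that[of A]) auto
qed

theorem theorem4p9:
  fixes Fq :: "'a::{field,finite} set"
    and q m n k l :: nat
    and ns :: "nat \<Rightarrow> nat"
    and C :: "'a vec set"
  assumes "subfield Fq class_ring" and "card Fq = q" and "card (UNIV :: 'a set) = q ^ m"
    and "completely_decomposable Fq m n k ns C"
    and "l \<in> {1..k - 1}"
    and "ns 0 = 0"
    and "\<forall>i\<in>{k - l..k}. ns i = ns k"
    and "ns (k - l) \<noteq> ns (k - l - 1)"
    and "real (weight_count Fq C (ns k)) =
           (real q ^ m - 1) * ((real q ^ ((l + 1) * (m - ns k)) - 1) / (real q ^ (m - ns k) - 1))"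
  shows "\<exists>r e. r > 1 \<and> e \<ge> 1 \<and> m = r * e \<and> ns k = (r - 1) * e \<and>
           (\<exists>D us u. equivalent_codes Fq n C D \<and>
              weight_complementary_form Fq n k ns us D \<and>
              entries_basis_of_hyperplane Fq e u \<and>
              punctured_code k us (k - l) = direct_sum_codes (replicate (l + 1) (line_code u))) \<and>
           (l = k - 1 \<longrightarrow>
              (\<exists>D u. equivalent_codes Fq n C D \<and>
                 entries_basis_of_hyperplane Fq e u \<and>
                 D = direct_sum_codes (replicate k (line_code u))))"
proof -
  let ?K = Fq and ?d = "ns k" and ?p = "k - l" and ?e = "m - ns k"
  \<comment> \<open>Since \<open>q ^ m = q ^ ?d * Q\<close>, this is the bound on the number of
    scalars mapping one space of dimension \<open>?d\<close> into another.\<close>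
  define Q where "Q = q ^ ?e"
  note K = assms(1)
  from assms(4) obtain D0 v where lin: "linear_code n k C"
    and ns: "\<And>i. i \<in> {1..k} \<Longrightarrow> 1 \<le> ns i \<and> ns i < m" and anti: "antimono_on {1..k} ns"
    and n: "n = (\<Sum>i=1..k. ns i)" and eq0: "equivalent_codes Fq n C D0"
    and wcf: "weight_complementary_form Fq n k ns v D0"
    unfolding completely_decomposable_def by blast
  obtain A0 where A0: "A0 \<in> GL_over n Fq" "D0 = (\<lambda>c. row_mult c A0) ` C"
    using eq0 unfolding equivalent_codes_def by blast
  have v: "v i \<in> carrier_vec (ns i)" "rank_weight Fq (v i) = ns i" if "i \<in> {1..k}" for i
    using wcf that by (auto simp: weight_complementary_form_def)
  have D0: "D0 = punctured_code k v 1"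
    using wcf unfolding weight_complementary_form_def generator_matrix_def image_row_mult_blocks by blast
  have l: "1 \<le> l" "l < k" using assms(5) by auto
  then have p: "1 \<le> ?p" "?p < k" by auto
  have q1: "q > 1" using card_subfield_gt_1[OF K] assms(2) by simp
  have dm: "0 < ?d" "?d < m" using ns[of k] l by auto
  have Q1: "Q > 1" unfolding Q_def using q1 dm by (intro one_less_power) auto
  define U where "U i = ring.Span class_ring Fq (list_of_vec (v i))" for i
  have card_U: "card (U i) = card Fq ^ ns i" if "i \<in> {1..k}" for i
    using card_Span[OF K, of "list_of_vec (v i)"] v(2)[OF that] by (simp add: U_def rank_weight_def)
  have ns_eq: "ns i = ?d" if "i \<in> {?p..k}" for i using assms(7) that by blast
  \<comment> \<open>The type is decreasing and drops strictly just before \<open>?p\<close>, so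
    every earlier block is longer. For \<open>?p = 1\<close> the range of \<open>i\<close> is
    empty.\<close>
  have ns_gt: "?d < ns i" if "i \<in> {1..<?p}" for i
  proof -
    have "ns (?p - 1) \<le> ns i" "ns ?p \<le> ns (?p - 1)"
      using anti that p by (auto simp: monotone_on_def)
    then show ?thesis using assms(8) ns_eq[of ?p] p by simp
  qed
  have diff: "x - y \<in> U i" if "x \<in> U i" "y \<in> U i" for i x y
    using that unfolding U_def by (rule Span_closed(3)[OF K])
  have card_pk: "card (U i) = q ^ ?d" if "i \<in> {?p..k}" for i
    using card_U[of i] ns_eq[OF that] that p assms(2) by simp

  \<comment> \<open>Equality in the count of words of minimum weight\<close>
  have dQ: "q ^ ?d * Q = card (UNIV :: 'a set)"
    using assms(3) dm by (simp add: Q_def power_add[symmetric])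
  let ?X = "{a \<in> {?p..k} \<rightarrow>\<^sub>E UNIV. (\<exists>i\<in>{?p..k}. a i \<noteq> 0) \<and>
      (\<exists>W. \<forall>i\<in>{?p..k}. a i \<noteq> 0 \<longrightarrow> (*) (a i) ` U i = W)}"
  have kp: "k - ?p + 1 = l + 1" using l by simp
  have count_le: "card ?X \<le> (card (UNIV :: 'a set) - 1) * (\<Sum>i<l + 1. Q ^ i)"
    unfolding kp[symmetric]
    by (rule count_aligned_tuples(1)[OF less_imp_le[OF p(2)] _ card_pk _ dQ Q1])
      (use q1 in \<open>simp_all add: diff\<close>)
  have count_eq: "card {c. (*) c ` U j \<subseteq> U ?p} = Q"
    if "card ?X = (card (UNIV :: 'a set) - 1) * (\<Sum>i<l + 1. Q ^ i)" "j \<in> {?p<..k}" for j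
    by (rule count_aligned_tuples(2)[OF less_imp_le[OF p(2)] _ card_pk _ dQ Q1 that(1)[folded kp] that(2)])
      (use q1 in \<open>simp_all add: diff\<close>)
  have "weight_count Fq C ?d \<le> weight_count Fq D0 ?d"
    unfolding A0(2) by (rule weight_count_equivalent_le[OF K A0(1) linear_code_carrier[OF lin]])
  also have "\<dots> \<le> card ?X"
    unfolding weight_count_def D0 U_def
    by (rule card_min_weight_words_le[OF K p(1) dm(1) card_U[unfolded U_def] ns_eq ns_gt])
  finally have le: "weight_count Fq C ?d \<le> card ?X" .
  \<comment> \<open>The fraction in the hypothesis is the closed form of the geometric sum in
    \<open>Q\<close> with \<open>l + 1\<close> terms.\<close>
  have "real (weight_count Fq C ?d) = real ((q ^ m - 1) * (\<Sum>i<l + 1. Q ^ i))"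
  proof -
    have "real (\<Sum>i<l + 1. Q ^ i) = (real Q ^ (l + 1) - 1) / (real Q - 1)"
      using geometric_sum[of "real Q" "l + 1"] Q1 by simp
    moreover have "real (q ^ m - 1) = real q ^ m - 1" using q1 by (simp add: of_nat_diff)
    moreover have "real q ^ ((l + 1) * ?e) = real Q ^ (l + 1)"
      unfolding Q_def of_nat_power power_mult[symmetric] by (simp add: mult.commute)
    moreover have "real q ^ ?e = real Q" by (simp add: Q_def)
    ultimately show ?thesis using assms(9) by (simp only: of_nat_mult)
  qed
  then have "weight_count Fq C ?d = (card (UNIV :: 'a set) - 1) * (\<Sum>i<l + 1. Q ^ i)"
    unfolding assms(3) by (simp only: of_nat_eq_iff)
  \<comment> \<open>The weight count is at most \<open>card ?X\<close>, which is at most the number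
    just computed, so the chain collapses to equalities.\<close>
  then have X_eq: "card ?X = (card (UNIV :: 'a set) - 1) * (\<Sum>i<l + 1. Q ^ i)"
    using le count_le by linarith
  note T = count_eq[OF X_eq]

  \<comment> \<open>The stabilizer of the common space as an intermediate field\<close>
  have stabilizer: "\<exists>b. b \<noteq> 0 \<and> (*) b ` U j = U ?p \<and> card {c. (*) c ` U ?p \<subseteq> U ?p} = Q"
    if j: "j \<in> {?p<..k}" for j
  proof -
    have "card (U j) = card (U ?p)" using card_pk[of j] card_pk[of ?p] j by auto
    moreover have "1 < card {c. (*) c ` U j \<subseteq> U ?p}" using T[OF j] Q1 by simp
    ultimately obtain b where "b \<noteq> 0" "(*) b ` U j = U ?p"
      "card {c. (*) c ` U ?p \<subseteq> U ?p} = card {c. (*) c ` U j \<subseteq> U ?p}"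
      by (rule scalars_into_eq_stabilizer)
    then show ?thesis using T[OF j] by (intro exI[of _ b]) simp
  qed
  have aligned: "\<exists>b. b \<noteq> 0 \<and> (*) b ` U j = U ?p" if "j \<in> {?p..k}" for j
  proof (cases "j = ?p")
    case True
    then show ?thesis by (intro exI[of _ 1]) simp
  next
    case False
    then have "j \<in> {?p<..k}" using that by auto
    from stabilizer[OF this] show ?thesis by blast
  qed
  \<comment> \<open>The condition \<open>l \<ge> 1\<close> makes \<open>k\<close> an index beyond
    \<open>?p\<close>, so a second block of length \<open>?d\<close> is available to compute the
    stabilizer.\<close>
  have "card {c. (*) c ` U ?p \<subseteq> U ?p} = Q" using stabilizer[of k] p by auto
  then have stab: "card {c. (*) c ` U ?p \<subseteq> U ?p} = card Fq ^ ?e" by (simp add: Q_def assms(2))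
  have Up: "0 \<in> U ?p" "card (U ?p) = card Fq ^ ?d"
    using card_pk[of ?p] p assms(2) Span_closed(1)[OF K] by (auto simp: U_def)
  obtain r where r: "r > 1" "m = r * ?e" "?d = (r - 1) * ?e"
    and L: "subfield {c. (*) c ` U ?p \<subseteq> U ?p} class_ring" "hyperplane_over {c. (*) c ` U ?p \<subseteq> U ?p} (U ?p)"
  proof (rule hyperplane_over_stabilizer[OF K _ dm Up(1) _ Up(2) stab])
    show "card (UNIV :: 'a set) = card Fq ^ m" using assms(2,3) by simp
    show "x - y \<in> U ?p" if "x \<in> U ?p" "y \<in> U ?p" for x y using that by (rule diff)
  qed (rule that)

  \<comment> \<open>The equivalent code whose last blocks coincide\<close>
  define us where "us i = (if ?p \<le> i then v ?p else v i)" for i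
  have vp: "v ?p \<in> carrier_vec ?d" "rank_weight Fq (v ?p) = ?d"
    using v[of ?p] ns_eq[of ?p] p by auto
  have ind: "ring.independent class_ring Fq (list_of_vec (v ?p))"
    by (rule independent_of_card_Span[OF K]) (use Up(2) vp(1) in \<open>simp add: U_def\<close>)
  have basis: "entries_basis_of_hyperplane Fq ?e (v ?p)"
    unfolding entries_basis_of_hyperplane_def basis_over_def
    using L stab ind by (intro exI[of _ "{c. (*) c ` U ?p \<subseteq> U ?p}"] exI[of _ "U ?p"]) (simp add: U_def)
  \<comment> \<open>From \<open>?p\<close> on, \<open>us\<close> repeats the block
    \<open>v ?p\<close>, reached up to the scalar \<open>inverse b\<close> with
    \<open>b U i = U ?p\<close>; earlier blocks stay fixed by the identity with scalar 1.\<close>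
  have "\<exists>A g. A \<in> GL_over (ns i) Fq \<and> g \<noteq> 0 \<and> row_mult (v i) A = g \<cdot>\<^sub>v us i" if i: "i \<in> {1..k}" for i
  proof (cases "?p \<le> i")
    case True
    then obtain b where b: "b \<noteq> 0" "(*) b ` U i = U ?p" using aligned[of i] i by auto
    have "ns i = ?d" using True i ns_eq[of i] by simp
    then obtain A where "A \<in> GL_over (ns i) Fq" "row_mult (v i) A = inverse b \<cdot>\<^sub>v v ?p"
      using exists_scaled_change_of_basis[OF K _ vp(1) ind b(1) b(2)[unfolded U_def]] v(1)[OF i] by metis
    then show ?thesis using b(1) True by (intro exI[of _ A] exI[of _ "inverse b"]) (simp add: us_def)
  next
    case False
    then show ?thesis
      using one_in_GL_over[OF K, of "ns i"] v(1)[OF i]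
      by (intro exI[of _ "1\<^sub>m (ns i)"] exI[of _ 1]) (simp add: us_def)
  qed
  then obtain A g where A: "\<And>i. i \<in> {1..k} \<Longrightarrow> A i \<in> GL_over (ns i) Fq"
    and g: "\<And>i. i \<in> {1..k} \<Longrightarrow> g i \<noteq> 0 \<and> row_mult (v i) (A i) = g i \<cdot>\<^sub>v us i"
    by metis
  define B where "B = diag_block_mat (map A [1..<Suc k])"
  have sum_ns: "sum_list (map ns [1..<Suc k]) = n"
    unfolding n by (simp add: interv_sum_list_conv_sum_set_nat atLeastLessThanSuc_atLeastAtMost del: upt_Suc)
  have B: "B \<in> GL_over n Fq"
    unfolding B_def sum_ns[symmetric] by (rule diag_block_mat_in_GL_over[OF K]) (use A in auto)
  define D where "D = punctured_code k us 1"
  have D: "D = (\<lambda>c. row_mult c B) ` D0"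
    unfolding D_def D0 B_def
    by (rule punctured_code_change_blocks[symmetric, where d = ns and g = g])
      (use g v(1) GL_over_D(1)[OF A] in auto)
  have D': "D = (\<lambda>c. row_mult c (A0 * B)) ` C"
    unfolding D A0(2) image_image
    using linear_code_carrier[OF lin]
    by (intro image_cong refl row_mult_mult[OF _ GL_over_D(1)[OF A0(1)] GL_over_D(1)[OF B]]) auto
  have AB: "A0 * B \<in> GL_over n Fq" by (rule mult_in_GL_over[OF K A0(1) B])
  have equiv: "equivalent_codes Fq n C D"
    unfolding equivalent_codes_def using AB D' by blast
  have "linear_code n k D" unfolding D' by (rule linear_code_row_mult[OF lin AB])
  moreover have us: "us i \<in> carrier_vec (ns i)" "rank_weight Fq (us i) = ns i" if "i \<in> {1..k}" for i
    using v[OF that] vp ns_eq[of i] that by (auto simp: us_def)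
  moreover have "diag_block_mat (map (\<lambda>i. mat_of_row (us i)) [1..<Suc k]) \<in> carrier_mat k n"
  proof (rule carrier_matI)
    have "map (\<lambda>i. dim_vec (us i)) [1..<Suc k] = map ns [1..<Suc k]"
      using us(1) by (intro map_cong refl) auto
    then show "dim_col (diag_block_mat (map (\<lambda>i. mat_of_row (us i)) [1..<Suc k])) = n"
      by (simp only: sum_ns[symmetric] dim_diag_block_mat map_map comp_def mat_of_row_dim)
    show "dim_row (diag_block_mat (map (\<lambda>i. mat_of_row (us i)) [1..<Suc k])) = k"
      by (simp add: dim_diag_block_mat comp_def sum_list_triv del: upt_Suc)
  qed
  ultimately have wcf': "weight_complementary_form Fq n k ns us D"
    unfolding weight_complementary_form_def generator_matrix_def image_row_mult_blocks D_def by blast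
  have punctured: "punctured_code k us ?p = direct_sum_codes (replicate (l + 1) (line_code (v ?p)))"
    unfolding kp[symmetric] using p by (intro punctured_code_const) (auto simp: us_def)
  \<comment> \<open>For \<open>l = k - 1\<close> the puncturing starts at the first block, so it is
    all of \<open>D\<close>.\<close>
  have "D = direct_sum_codes (replicate k (line_code (v ?p)))" if "l = k - 1"
  proof -
    have "?p = 1" "l + 1 = k" using that l by auto
    then show ?thesis using punctured by (simp add: D_def)
  qed
  then show ?thesis
    using r dm equiv wcf' basis punctured by (intro exI[of _ r] exI[of _ ?e]) auto
qed

end
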